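(* Let $\{x^\nu\}$ be a sequence of iterates produced by the SPSA with $\gamma_\nu$ equal to a constant $\underline\gamma>0$ for all $\nu$. Let $\kappa\subseteq\{1,2,\dots\}$ be any infinite index set such that $\lim_{\nu(\in\kappa)\to\infty}\|x^{\nu+1}-x^\nu\|=0$ with probability 1. Then, almost surely, the following two statements hold for any accumulation point $x^\infty$ of the subsequence $\{x^\nu\}_{\nu\in\kappa}$. (a) Consider the surrogate problem at $x^\infty$: $$(\mathrm P_\infty)\qquad \operatorname*{minimize}_{x\in X}\ \mathbb E[\widehat c_0(x,\tilde z;x^\infty)]\quad\text{subject to}\quad \widehat c_k(x;\underline\gamma;x^\infty):=\mathbb E[\widehat c_k(x,\tilde z;\underline\gamma;x^\infty)]\le\zeta_k,\ k\in[K].$$ If $(\mathrm P_\infty)$ has a feasible solution $\widehat x$ satisfying $$\frac1{\lambda_\infty}\,\mathbb E[\widehat c_0(\widehat x,\tilde z;x^\infty)]\ \le\ \frac1{\lambda_\infty}\,\mathbb E[\widehat c_0(x^\infty,\tilde z;x^\infty)]$$ (trivially satisfied if $\lambda_\infty=+\infty$), then $x^\infty$ is feasible to the problem $$(\mathrm P_{\underline\gamma})\qquad \operatorname*{minimize}_{x\in X}\ \bar c_0(x)\quad\text{subject to}\quad \bar c_k(x;\underline\gamma)\le\zeta_k,\ k\in[K],$$ or equivalently, feasible to $(\mathrm P_\infty)$. (b) Assume that the vector $\widehat x$ in (a) exists. Then, under the constraint closure condition $$\emptyset\ne\bigcap_{k=1}^K\{x\in X:\widehat c_k(x;\underline\gamma;x^\infty)\le\zeta_k\}\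 \subseteq\ \mathrm{cl}\Big(\bigcap_{k=1}^K\{x\in X:\widehat c_k(x;\underline\gamma;x^\infty)<\zeta_k\}\Big),$$ $x^\infty$ is a B-stationary point of $(\mathrm P_\infty)$. If additionally $x^\infty$ (which is feasible to $(\mathrm P_{\underline\gamma})$) satisfies the directional Slater condition $$\bigcap_{k\in\mathcal A(x^\infty;\underline\gamma)}\{v\in\mathcal T(x^\infty;X):\bar c_k(\bullet;\underline\gamma)'(x^\infty;v)\le0\}\ \subseteq\ \mathrm{cl}\Big(\bigcap_{k\in\mathcal A(x^\infty;\underline\gamma)}\{v\in\mathcal T(x^\infty;X):\bar c_k(\bullet;\underline\gamma)'(x^\infty;v)<0\}\Big),$$ where $\mathcal A(x^\infty;\underline\gamma)=\{k\in[K]:\bar c_k(x^\infty;\underline\gamma)=\zeta_k\}$, then $x^\infty$ is a B-stationary point of $(\mathrm P_{\underline\gamma})$.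
   Context: Notation: $[K]=\{1,\dots,K\}$; $1/\infty=0$; cl is closure; $f'(x;v)$ is the one-sided directional derivative; $\mathcal T(x;C)$ is the Bouligand tangent cone. A function is B-differentiable at a point if it is locally Lipschitz continuous and directionally differentiable there. A point $\bar x\in C$ is a B-stationary point of minimizing $f$ over $C$ if $f'(\bar x;v)\ge0$ for all $v\in\mathcal T(\bar x;C)$. Problem data. $X\subseteq\mathcal O\subseteq\mathbb R^n$ ($\mathcal O$ open), $\tilde z$ is a random vector with values in $\Xi\subseteq\mathbb R^d$, $\zeta_k\in\mathbb R$. For $\gamma>0$, $c_k(x,z;\gamma)=\sum_{\ell=1}^L c_{k\ell}(x,z;\gamma)$, $\bar c_k(x;\gamma)=\mathbb E[c_k(x,\tilde z;\gamma)]$ for $k\in[K]$, and $\bar c_0(x)=\mathbb E[c_0(x,\tilde z)]$. Standing assumptions. (1) $X$ is a polytope (bounded polyhedron); $c_0(\bullet,z)\ge0$ on $X$ for all $z\in\Xi$. (2) $c_0(\bullet,z)$ is directionally differentiable and globally Lipschitz continuous with constant $\mathrm{Lip}_0(z)>0$, $\mathbb E[\mathrm{Lip}_0(\tilde z)]<\infty$. (3) There exist integrable $\mathrm{Lip}_{\rm c},\widehat{\mathrm{Lip}}_{\rm c}:\Xi\to(0,\infty)$ and a probability-one set $\Xi_{\rm c}$ with $\sup_{z\in\Xi_{\rm c}}\mathrm{Lip}_{\rm c}(z)<\infty$ such that for all $k,\ell$, all $z\in\Xi_{\rm c}$, all $x,x^1,x^2\in X$ and $\gamma,\gamma_1,\gamma_2>0$: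 $|c_{k\ell}(x^1,z;\gamma)-c_{k\ell}(x^2,z;\gamma)|\le\frac{\mathrm{Lip}_{\rm c}(z)}{\gamma}\|x^1-x^2\|$ and $|c_{k\ell}(x,z;\gamma_1)-c_{k\ell}(x,z;\gamma_2)|\le\widehat{\mathrm{Lip}}_{\rm c}(z)[1+\|x\|]\,|\frac1{\gamma_1}-\frac1{\gamma_2}|$. (4) Each $\bar c_k(\bullet;\gamma)$ is directionally differentiable with $\bar c_k(\bullet;\gamma)'(\bar x;v)=\sum_{\ell=1}^L\mathbb E[c_{k\ell}(\bullet,\tilde z;\gamma)'(\bar x;v)]$ for all $\bar x\in X$, $\gamma>0$, $v\in\mathbb R^n$. (5) (Growth of Rademacher averages) For $f:X\times\Xi\to\mathbb R$ let $\mathbf R_N(f,\Xi)=\sup_{(\xi_1,\dots,\xi_N)\in\Xi^N}\mathbb E_\sigma\big[\sup_{x\in X}|\frac1N\sum_{i=1}^N\sigma_i f(x,\xi_i)|\big]$, with $\sigma_i$ i.i.d. uniform on $\{+1,-1\}$. There exist positive constants $W_0,W_1,W_2$ such that for all integers $N>0$ and all $\beta\in(0,1/2)$: $\mathbf R_N(c_0,\Xi)\le W_0/N^\beta$ and $\max_{k\in[K]}\mathbf R_N(c_k(\bullet,\bullet;\gamma),\Xi)\le \frac{W_1}{N^\beta}+\frac{W_2}{\gamma\sqrt N}$ for all $\gamma>0$. (6) (Surrogates) For every $\bar x\in X$, $z\in\Xi$, $k\in[K]$, $\gamma>0$ a function $\widehat c_k(\bullet,z;\gamma;\bar x)$ is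 given with: (a) it is B-differentiable on $X$; (b) $\widehat c_k(x,z;\gamma;\bar x)\ge c_k(x,z;\gamma)$ for all $x\in X$; (c) $\widehat c_k(\bar x,z;\gamma;\bar x)=c_k(\bar x,z;\gamma)$; (d) $\widehat c_k(\bullet,z;\gamma;\bullet)$ is upper semicontinuous on $X\times X$; (e) $\widehat c_k(\bullet,z;\gamma;\bar x)'(\bar x;d)=c_k(\bullet,z;\gamma)'(\bar x;d)$ for all $d\in\mathbb R^n$. A surrogate $\widehat c_0(\bullet,z;\bar x)$ of $c_0(\bullet,z)$ satisfying the same five conditions is also given. Parameters. $\{N_\nu\}_{\nu\ge0}$ is an increasing sequence of integers with $N_0=0$; $\{\lambda_\nu\}_{\nu\ge1}$ is nondecreasing, positive, with $\lambda_1=1$ and limit $\lambda_\infty\in[1,\infty]$; $\{\rho_\nu\}_{\nu\ge1}$ is positive with limit $\rho_\infty\in[0,\infty)$ and, for some constants $\alpha_2>\alpha_1>0$, $\frac{\alpha_1}\nu\le\frac{\rho_\nu}{\lambda_\nu}\le\frac{\alpha_2}\nu$ for all $\nu$; $\{\gamma_\nu\}_{\nu\ge1}$ is positive and nonincreasing with limit $\ge 0$ and $\sum_{\nu\ge2}\sup_{x\in X}|\bar c_k(x;\gamma_\nu)-\bar c_k(x;\gamma_{\nu-1})|<\infty$ for $k\in[K]$ (automatic for constant $\gamma_\nu$). Moreover there exist $\beta\in(0,1/2)$, a positive integer $\bar\nu$ and positive scalars $\delta,c_1,c_2,c_3,c_4$ with $c_3<\bar\nu$ and $\beta(1+c_1)>1+\delta$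 such that $c_2\nu^{1+c_1}\le N_\nu\le N_{\nu-1}/(1-\frac{c_3}\nu)$ and $\gamma_\nu\ge c_4/\nu^\delta$ for all $\nu\ge\bar\nu$. SPSA algorithm. Let $z^1,z^2,\dots$ be i.i.d. samples of $\tilde z$ and $Z^{N}=\{z^s\}_{s=1}^N$. Start with an arbitrary $x^1\in X$; for $\nu=1,2,\dots$ let $x^{\nu+1}$ be a global minimizer over $x\in X$ of $$\widehat V_{\lambda_\nu}^{\rho_\nu}(x,Z^{N_\nu};\gamma_\nu;x^\nu)=\frac1{N_\nu}\sum_{s=1}^{N_\nu}\widehat c_0(x,z^s;x^\nu)+\lambda_\nu\sum_{k=1}^K\max\Big(\frac1{N_\nu}\sum_{s=1}^{N_\nu}\widehat c_k(x,z^s;\gamma_\nu;x^\nu)-\zeta_k,\,0\Big)+\frac{\rho_\nu}2\|x-x^\nu\|^2 .$$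
   Formalization: It is added that the expected surrogates are finite on the open set, that the surrogates are jointly measurable with an integrable upper bound on X×X, and that at its base point each expected surrogate is B-differentiable with derivative and expectation interchangeable. *)

theory Defs
  imports "HOL-Probability.Probability"
begin

section \<open>Directional derivatives, tangent cones, stationarity\<close>

definition has_dir_deriv :: "('a::real_normed_vector \<Rightarrow> real) \<Rightarrow> 'a \<Rightarrow> 'a \<Rightarrow> real \<Rightarrow> bool" where
  "has_dir_deriv f x v D \<longleftrightarrow> ((\<lambda>t. (f (x + t *\<^sub>R v) - f x) / t) \<longlongrightarrow> D) (at_right 0)"

definition dir_differentiable_at :: "('a::real_normed_vector \<Rightarrow> real) \<Rightarrow> 'a \<Rightarrow> bool" where
  "dir_differentiable_at f x \<longleftrightarrow> (\<forall>v. \<exists>D. has_dir_deriv f x v D)"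

text \<open>Unspecified if the limit does not exist.\<close>
definition dir_deriv :: "('a::real_normed_vector \<Rightarrow> real) \<Rightarrow> 'a \<Rightarrow> 'a \<Rightarrow> real" where
  "dir_deriv f x v = (THE D. has_dir_deriv f x v D)"

definition b_differentiable_at :: "('a::real_normed_vector \<Rightarrow> real) \<Rightarrow> 'a \<Rightarrow> bool" where
  "b_differentiable_at f x \<longleftrightarrow>
     (\<exists>e>0. \<exists>B. B-lipschitz_on (ball x e) f) \<and> dir_differentiable_at f x"

definition tangent_cone :: "'a::real_normed_vector \<Rightarrow> 'a set \<Rightarrow> 'a set" where
  "tangent_cone x C = {v. \<exists>y \<tau>. (\<forall>j::nat. y j \<in> C \<and> \<tau> j > 0) \<and> y \<longlonglongrightarrow> x \<and> \<tau> \<longlonglongrightarrow> 0 \<and>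
      (\<lambda>j. (y j - x) /\<^sub>R \<tau> j) \<longlonglongrightarrow> v}"

text \<open>Existence of the directional derivatives in question is part of the notion.\<close>
definition b_stationary :: "('a::real_normed_vector \<Rightarrow> real) \<Rightarrow> 'a set \<Rightarrow> 'a \<Rightarrow> bool" where
  "b_stationary f C x \<longleftrightarrow>
     x \<in> C \<and> (\<forall>v \<in> tangent_cone x C. \<exists>D. has_dir_deriv f x v D \<and> D \<ge> 0)"

definition usc_on :: "'a::topological_space set \<Rightarrow> ('a \<Rightarrow> real) \<Rightarrow> bool" where
  "usc_on S f \<longleftrightarrow> (\<forall>x\<in>S. \<forall>a>f x. \<forall>\<^sub>F y in at x within S. f y < a)"


section \<open>Random functions\<close>

text \<open>The range set \<open>\<Xi>\<close> of the random vector carries the trace of the Borel sigma-algebra.\<close>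
definition random_integrable ::
  "'w measure \<Rightarrow> ('w \<Rightarrow> 'z::topological_space) \<Rightarrow> 'z set \<Rightarrow> ('z \<Rightarrow> real) \<Rightarrow> bool" where
  "random_integrable M zt \<Xi> f \<longleftrightarrow>
     f \<in> borel_measurable (restrict_space borel \<Xi>) \<and> integrable M (\<lambda>\<omega>. f (zt \<omega>))"

definition expval :: "'w measure \<Rightarrow> ('w \<Rightarrow> 'z) \<Rightarrow> ('a \<Rightarrow> 'z \<Rightarrow> real) \<Rightarrow> 'a \<Rightarrow> real" where
  "expval M zt f x = (\<integral>\<omega>. f x (zt \<omega>) \<partial>M)"

text \<open>Empirical Rademacher average, in \<open>[0,\<infinity>]\<close> so that the suprema are meaningful without
  boundedness assumptions.\<close>
definition rademacher :: "'a set \<Rightarrow> 'z set \<Rightarrow> ('a \<Rightarrow> 'z \<Rightarrow> real) \<Rightarrow> nat \<Rightarrow> ennreal" where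
  "rademacher X \<Xi> f N =
     (SUP \<xi>\<in>{1..N} \<rightarrow> \<Xi>. \<integral>\<^sup>+\<sigma>. (SUP x\<in>X. ennreal \<bar>(1 / real N) * (\<Sum>i=1..N. \<sigma> i * f x (\<xi> i))\<bar>)
        \<partial>measure_pmf (Pi_pmf {1..N} 0 (\<lambda>_. pmf_of_set {1, -1})))"

text \<open>Measurability of a random upper semicontinuous function, i.e. measurability of its
  hypograph as a random closed set: the suprema over open sets are measurable.\<close>
definition random_usc_measurable ::
  "'z::topological_space set \<Rightarrow> 'p::topological_space set \<Rightarrow> ('p \<Rightarrow> 'z \<Rightarrow> real) \<Rightarrow> bool" where
  "random_usc_measurable \<Xi> S f \<longleftrightarrow>
     (\<forall>U. open U \<longrightarrow> (\<lambda>z. SUP p\<in>S \<inter> U. ereal (f p z)) \<in> borel_measurable (restrict_space borel \<Xi>))"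


section \<open>Surrogate functions\<close>

text \<open>\<open>ch x z y\<close> is the value at \<open>x\<close> of the surrogate of \<open>c(\<bullet>, z)\<close> constructed at \<open>y\<close>.\<close>
definition surrogate ::
  "'a::real_normed_vector set \<Rightarrow> 'z set \<Rightarrow> ('a \<Rightarrow> 'z \<Rightarrow> real) \<Rightarrow> ('a \<Rightarrow> 'z \<Rightarrow> 'a \<Rightarrow> real) \<Rightarrow> bool" where
  "surrogate X \<Xi> c ch \<longleftrightarrow> (\<forall>z\<in>\<Xi>.
      (\<forall>y\<in>X. (\<forall>x\<in>X. b_differentiable_at (\<lambda>u. ch u z y) x) \<and>
              (\<forall>x\<in>X. ch x z y \<ge> c x z) \<and>
              ch y z y = c y z \<and>
              (\<forall>d. \<exists>D. has_dir_deriv (\<lambda>u. ch u z y) y d D \<and> has_dir_deriv (\<lambda>u. c u z) y d D)) \<and>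
      usc_on (X \<times> X) (\<lambda>(x, y). ch x z y))"

text \<open>Conditions under which the expectations of the surrogates behave as functions of the
  deterministic variables: the expectations are finite on the domain \<open>\<Omega>\<close>, the surrogates are
  measurable and have an integrable upper bound on \<open>X \<times> X\<close>, and at the base point the expected
  surrogate is B-differentiable with directional derivative and expectation interchangeable.\<close>
definition integrable_surrogate ::
  "'w measure \<Rightarrow> ('w \<Rightarrow> 'z::topological_space) \<Rightarrow> 'z set \<Rightarrow> 'a::real_normed_vector set \<Rightarrow> 'a set \<Rightarrow>
   ('a \<Rightarrow> 'z \<Rightarrow> 'a \<Rightarrow> real) \<Rightarrow> bool" where
  "integrable_surrogate M zt \<Xi> \<Omega> X ch \<longleftrightarrow>
     (\<forall>x\<in>\<Omega>. \<forall>y\<in>X. integrable M (\<lambda>\<omega>. ch x (zt \<omega>) y)) \<and>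
     random_usc_measurable \<Xi> (X \<times> X) (\<lambda>(x, y) z. ch x z y) \<and>
     (\<exists>B. random_integrable M zt \<Xi> B \<and> (\<forall>z\<in>\<Xi>. \<forall>x\<in>X. \<forall>y\<in>X. ch x z y \<le> B z)) \<and>
     (\<forall>y\<in>X. b_differentiable_at (expval M zt (\<lambda>x z. ch x z y)) y \<and>
        (\<forall>v. dir_deriv (expval M zt (\<lambda>x z. ch x z y)) y v
              = (\<integral>\<omega>. dir_deriv (\<lambda>x. ch x (zt \<omega>) y) y v \<partial>M)))"


section \<open>Constrained problems\<close>

definition feasible_set :: "'a set \<Rightarrow> nat \<Rightarrow> (nat \<Rightarrow> 'a \<Rightarrow> real) \<Rightarrow> (nat \<Rightarrow> real) \<Rightarrow> 'a set" where
  "feasible_set X K g \<zeta> = {x\<in>X. \<forall>k\<in>{1..K}. g k x \<le> \<zeta> k}"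

definition strictly_feasible_set ::
  "'a set \<Rightarrow> nat \<Rightarrow> (nat \<Rightarrow> 'a \<Rightarrow> real) \<Rightarrow> (nat \<Rightarrow> real) \<Rightarrow> 'a set" where
  "strictly_feasible_set X K g \<zeta> = {x\<in>X. \<forall>k\<in>{1..K}. g k x < \<zeta> k}"

definition constraint_closure ::
  "'a::topological_space set \<Rightarrow> nat \<Rightarrow> (nat \<Rightarrow> 'a \<Rightarrow> real) \<Rightarrow> (nat \<Rightarrow> real) \<Rightarrow> bool" where
  "constraint_closure X K g \<zeta> \<longleftrightarrow>
     feasible_set X K g \<zeta> \<noteq> {} \<and> feasible_set X K g \<zeta> \<subseteq> closure (strictly_feasible_set X K g \<zeta>)"

definition active_set :: "nat \<Rightarrow> (nat \<Rightarrow> 'a \<Rightarrow> real) \<Rightarrow> (nat \<Rightarrow> real) \<Rightarrow> 'a \<Rightarrow> nat set" where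
  "active_set K g \<zeta> x = {k\<in>{1..K}. g k x = \<zeta> k}"

definition directional_slater ::
  "'a::real_normed_vector set \<Rightarrow> nat \<Rightarrow> (nat \<Rightarrow> 'a \<Rightarrow> real) \<Rightarrow> (nat \<Rightarrow> real) \<Rightarrow> 'a \<Rightarrow> bool" where
  "directional_slater X K g \<zeta> x \<longleftrightarrow>
     {v \<in> tangent_cone x X. \<forall>k\<in>active_set K g \<zeta> x. dir_deriv (g k) x v \<le> 0}
     \<subseteq> closure {v \<in> tangent_cone x X. \<forall>k\<in>active_set K g \<zeta> x. dir_deriv (g k) x v < 0}"


section \<open>The SPSA algorithm\<close>

text \<open>\<open>cbar k x \<gamma>\<close> is the expected \<open>k\<close>-th constraint function.  Indices of \<open>lam\<close>, \<open>rho\<close>, \<open>gam\<close>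
  start at 1.\<close>
definition spsa_parameters ::
  "'a set \<Rightarrow> nat \<Rightarrow> (nat \<Rightarrow> 'a \<Rightarrow> real \<Rightarrow> real) \<Rightarrow> (nat \<Rightarrow> nat) \<Rightarrow> (nat \<Rightarrow> real) \<Rightarrow> ereal \<Rightarrow>
   (nat \<Rightarrow> real) \<Rightarrow> real \<Rightarrow> (nat \<Rightarrow> real) \<Rightarrow> bool" where
  "spsa_parameters X K cbar N lam lam_inf rho rho_inf gam \<longleftrightarrow>
     strict_mono N \<and> N 0 = 0 \<and>
     mono_on {1..} lam \<and> (\<forall>\<nu>\<ge>1. lam \<nu> > 0) \<and> lam 1 = 1 \<and>
     (\<lambda>\<nu>. ereal (lam \<nu>)) \<longlonglongrightarrow> lam_inf \<and>
     (\<forall>\<nu>\<ge>1. rho \<nu> > 0) \<and> rho \<longlonglongrightarrow> rho_inf \<and>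
     (\<exists>\<alpha>1 \<alpha>2. 0 < \<alpha>1 \<and> \<alpha>1 < \<alpha>2 \<and>
        (\<forall>\<nu>\<ge>1. \<alpha>1 / real \<nu> \<le> rho \<nu> / lam \<nu> \<and> rho \<nu> / lam \<nu> \<le> \<alpha>2 / real \<nu>)) \<and>
     (\<forall>\<nu>\<ge>1. gam \<nu> > 0) \<and> antimono_on {1..} gam \<and> (\<exists>g\<ge>0. gam \<longlonglongrightarrow> g) \<and>
     (\<forall>k\<in>{1..K}. (\<Sum>i. SUP x\<in>X. ennreal \<bar>cbar k x (gam (i + 2)) - cbar k x (gam (i + 1))\<bar>) < \<infinity>) \<and>
     (\<exists>\<beta> nubar \<delta> c1 c2 c3 c4. 0 < \<beta> \<and> \<beta> < 1/2 \<and> (nubar::nat) > 0 \<and>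
        \<delta> > 0 \<and> c1 > 0 \<and> c2 > 0 \<and> c3 > 0 \<and> c4 > 0 \<and>
        c3 < real nubar \<and> \<beta> * (1 + c1) > 1 + \<delta> \<and>
        (\<forall>\<nu>\<ge>nubar. c2 * real \<nu> powr (1 + c1) \<le> real (N \<nu>) \<and>
                   real (N \<nu>) \<le> real (N (\<nu> - 1)) / (1 - c3 / real \<nu>) \<and>
                   gam \<nu> \<ge> c4 / real \<nu> powr \<delta>))"

definition spsa_objective ::
  "nat \<Rightarrow> (nat \<Rightarrow> real) \<Rightarrow> ('a::real_normed_vector \<Rightarrow> 'z \<Rightarrow> 'a \<Rightarrow> real) \<Rightarrow>
   (nat \<Rightarrow> 'a \<Rightarrow> 'z \<Rightarrow> real \<Rightarrow> 'a \<Rightarrow> real) \<Rightarrow> (nat \<Rightarrow> 'z) \<Rightarrow> nat \<Rightarrow> real \<Rightarrow> real \<Rightarrow> real \<Rightarrow> 'a \<Rightarrow> 'a \<Rightarrow> real" where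
  "spsa_objective K \<zeta> ch0 ch z N lam rho gam y x =
     (1 / real N) * (\<Sum>s=1..N. ch0 x (z s) y)
     + lam * (\<Sum>k=1..K. max ((1 / real N) * (\<Sum>s=1..N. ch k x (z s) gam y) - \<zeta> k) 0)
     + rho / 2 * (norm (x - y))\<^sup>2"

definition spsa_iterates ::
  "'a::real_normed_vector set \<Rightarrow> nat \<Rightarrow> (nat \<Rightarrow> real) \<Rightarrow> ('a \<Rightarrow> 'z \<Rightarrow> 'a \<Rightarrow> real) \<Rightarrow>
   (nat \<Rightarrow> 'a \<Rightarrow> 'z \<Rightarrow> real \<Rightarrow> 'a \<Rightarrow> real) \<Rightarrow> (nat \<Rightarrow> nat) \<Rightarrow> (nat \<Rightarrow> real) \<Rightarrow> (nat \<Rightarrow> real) \<Rightarrow>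
   (nat \<Rightarrow> real) \<Rightarrow> (nat \<Rightarrow> 'z) \<Rightarrow> (nat \<Rightarrow> 'a) \<Rightarrow> bool" where
  "spsa_iterates X K \<zeta> ch0 ch N lam rho gam z x \<longleftrightarrow>
     x 1 \<in> X \<and>
     (\<forall>\<nu>\<ge>1. is_arg_min (spsa_objective K \<zeta> ch0 ch z (N \<nu>) (lam \<nu>) (rho \<nu>) (gam \<nu>) (x \<nu>))
                (\<lambda>y. y \<in> X) (x (\<nu> + 1)))"

definition accumulation_point_along ::
  "nat set \<Rightarrow> (nat \<Rightarrow> 'a::topological_space) \<Rightarrow> 'a \<Rightarrow> bool" where
  "accumulation_point_along \<kappa> x l \<longleftrightarrow>
     (\<exists>r. strict_mono r \<and> range r \<subseteq> \<kappa> \<and> (\<lambda>j. x (r j)) \<longlonglongrightarrow> l)"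

end

theory Submission
  imports Defs
begin

text \<open>
  Almost surely, sample averages of the surrogates have one-sided limits that are locally uniform in
  both variables: an upper semicontinuous integrand is dominated near a point by its supremum over a
  small neighbourhood, whose expectation is nearly that of the integrand, while from below the
  surrogates are bounded by the original Lipschitz functions. Both bounds only need the strong law of
  large numbers for countably many integrands.

  Along a subsequence of \<open>\<kappa>\<close> converging to \<open>x\<^sup>\<infinity>\<close>, consecutive iterates have the same limit. Comparing
  the minimizer with a fixed \<open>u\<close> and dividing by the penalty parameter gives feasibility of \<open>x\<^sup>\<infinity>\<close>; for
  strictly feasible \<open>u\<close> the penalty vanishes and the limit is
  \<open>f (x\<^sup>\<infinity>) \<le> f u + \<rho> / 2 * norm (u - x\<^sup>\<infinity>) ^ 2\<close>, where \<open>f\<close> is the expected surrogate objective. This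
  extends to all feasible \<open>u\<close> near \<open>x\<^sup>\<infinity>\<close> by the constraint closure condition, and it implies
  B-stationarity because the quadratic term is negligible along tangent sequences. Expected surrogates
  and original expectations have the same values and directional derivatives at \<open>x\<^sup>\<infinity>\<close>, so under the
  directional Slater condition stationarity passes to the original problem.
\<close>

section \<open>The strong law of large numbers\<close>

text \<open>The maximum of the partial sums of \<open>f (y 0), ..., f (y (n - 1))\<close>, the empty one included,
  written as a recursion along the shift.\<close>
primrec drift :: "('a \<Rightarrow> real) \<Rightarrow> nat \<Rightarrow> (nat \<Rightarrow> 'a) \<Rightarrow> real" where
  "drift f 0 y = 0"
| "drift f (Suc n) y = max 0 (f (y 0) + drift f n (\<lambda>i. y (Suc i)))"

lemma drift_nonneg: "drift f n y \<ge> 0"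
  by (cases n) auto

lemma drift_mono: "drift f n y \<le> drift f (Suc n) y"
proof (induction n arbitrary: y)
  case (Suc n)
  show ?case using Suc[of "\<lambda>i. y (Suc i)"] by (subst (1 2) drift.simps) linarith
qed simp

lemma incseq_drift: "incseq (\<lambda>n. drift f n y)"
  by (rule incseq_SucI) (rule drift_mono)

lemma sum_le_drift: "(\<Sum>i<n. f (y i)) \<le> drift f n y"
proof (induction n arbitrary: y)
  case (Suc n)
  show ?case using Suc[of "\<lambda>i. y (Suc i)"]
    by (simp add: sum.lessThan_Suc_shift del: sum.lessThan_Suc)
qed simp

lemma drift_le_sum_abs: "drift f n y \<le> (\<Sum>i<n. \<bar>f (y i)\<bar>)"
proof (induction n arbitrary: y)
  case (Suc n)
  have "0 \<le> (\<Sum>i<n. \<bar>f (y (Suc i))\<bar>)" by (intro sum_nonneg) auto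
  then show ?case using Suc[of "\<lambda>i. y (Suc i)"]
    by (simp add: sum.lessThan_Suc_shift del: sum.lessThan_Suc)
qed simp

context sequence_space
begin

lemma measurable_shift: "(\<lambda>y i. y (Suc i)) \<in> measurable S S"
  by (rule measurable_PiM_single') (auto simp: space_PiM intro!: measurable_component_singleton)

lemma measurable_drift [measurable]:
  assumes f: "f \<in> borel_measurable M"
  shows "drift f n \<in> borel_measurable S"
proof (induction n)
  case (Suc n)
  have "(\<lambda>y. drift f n (\<lambda>i. y (Suc i))) \<in> borel_measurable S"
    using measurable_compose[OF measurable_shift Suc] by simp
  moreover have "(\<lambda>y. f (y 0)) \<in> borel_measurable S"
    by (rule measurable_compose[OF _ f]) (rule measurable_component_singleton, simp)
  ultimately show ?case by simp
qed simp

lemma integrable_component: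
  assumes f: "integrable M f"
  shows "integrable S (\<lambda>y. f (y i) :: real)"
proof -
  have "distr S M (\<lambda>y. y i) = M" by (rule PiM_component) simp
  then have "integrable (distr S M (\<lambda>y. y i)) f" using f by simp
  then show ?thesis
    by (subst (asm) integrable_distr_eq) (auto intro: borel_measurable_integrable f)
qed

lemma integrable_drift:
  assumes f: "integrable M f"
  shows "integrable S (drift f n)"
proof (rule Bochner_Integration.integrable_bound)
  show "integrable S (\<lambda>y. \<Sum>i<n. \<bar>f (y i)\<bar>)"
    using integrable_component[OF f] by auto
  show "drift f n \<in> borel_measurable S" using f by (simp add: borel_measurable_integrable measurable_drift)
  show "AE y in S. norm (drift f n y) \<le> norm (\<Sum>i<n. \<bar>f (y i)\<bar>)"
    using drift_le_sum_abs[of f n] drift_nonneg[of f n] by (auto intro!: AE_I2 order_trans[OF _ abs_ge_self])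
qed

lemma AE_bdd_above_drift:
  assumes f: "integrable M f" and neg: "(\<integral>x. f x \<partial>M) < 0"
  shows "AE y in S. bdd_above (range (\<lambda>n. drift f n y))"
proof -
  text \<open>The event \<open>A\<close> of unbounded partial sums does not depend on the first coordinate. By stationarity
    the expected increment of \<open>drift f n\<close> on \<open>A\<close> is the expectation of \<open>max (- drift f n y) (f x)\<close>
    over \<open>y \<in> A\<close> and an independent \<open>x\<close>; it is nonnegative and tends to \<open>E f * P A\<close>.\<close>
  note [measurable] = borel_measurable_integrable[OF f]
  interpret Q: pair_prob_space M S ..
  define A where "A = {y \<in> space S. \<forall>m::nat. \<exists>n. drift f n y > real m}"
  have A_sets [measurable]: "A \<in> sets S" unfolding A_def by measurable
  have unb: "\<not> bdd_above (range (\<lambda>n. drift f n y)) \<longleftrightarrow> (\<forall>m::nat. \<exists>n. drift f n y > real m)" for y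
  proof
    assume "\<not> bdd_above (range (\<lambda>n. drift f n y))"
    then show "\<forall>m::nat. \<exists>n. drift f n y > real m"
      by (auto simp: bdd_above_def not_le)
  next
    assume *: "\<forall>m::nat. \<exists>n. drift f n y > real m"
    show "\<not> bdd_above (range (\<lambda>n. drift f n y))"
    proof
      assume "bdd_above (range (\<lambda>n. drift f n y))"
      then obtain b where b: "\<And>n. drift f n y \<le> b" by (auto simp: bdd_above_def)
      obtain m :: nat where "real m \<ge> b" using real_arch_simple by blast
      with * b show False by (meson le_less_trans not_le)
    qed
  qed
  have step: "drift f (Suc n) (case_nat x y) = max 0 (f x + drift f n y)" for n x y by simp
  \<comment> \<open>Prepending a coordinate shifts all partial sums by the fixed number
    \<open>f x\<close>, up to the truncation at 0, and so preserves boundedness in both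
    directions.\<close>
  have A_cons: "case_nat x y \<in> A \<longleftrightarrow> y \<in> A" if "x \<in> space M" "y \<in> space S" for x y
  proof -
    have "case_nat x y \<in> space S" using that by (auto simp: space_PiM PiE_iff split: nat.split)
    moreover have "bdd_above (range (\<lambda>n. drift f n (case_nat x y))) \<longleftrightarrow> bdd_above (range (\<lambda>n. drift f n y))"
    proof
      assume "bdd_above (range (\<lambda>n. drift f n (case_nat x y)))"
      then obtain b where "\<And>n. drift f n (case_nat x y) \<le> b" by (auto simp: bdd_above_def)
      then have "f x + drift f n y \<le> b" for n using step[of n x y] by (metis max.bounded_iff)
      then show "bdd_above (range (\<lambda>n. drift f n y))"
        by (auto simp: bdd_above_def algebra_simps intro!: exI[of _ "b - f x"])
    next
      assume "bdd_above (range (\<lambda>n. drift f n y))"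
      then obtain b where b: "\<And>n. drift f n y \<le> b" by (auto simp: bdd_above_def)
      have "drift f n (case_nat x y) \<le> max 0 (f x + b)" for n
        using b[of "n - 1"] step[of "n - 1" x y] by (cases n) (auto simp: max_def)
      then show "bdd_above (range (\<lambda>n. drift f n (case_nat x y)))" by (auto simp: bdd_above_def)
    qed
    ultimately show ?thesis using that unb by (auto simp: A_def)
  qed
  define a :: "(nat \<Rightarrow> 'a) \<Rightarrow> real" where "a = indicator A"
  have [measurable]: "a \<in> borel_measurable S" unfolding a_def by measurable
  have a01: "0 \<le> a y" "a y \<le> 1" for y by (auto simp: a_def indicator_def)
  have int_a: "integrable S (\<lambda>y. a y * drift f n y)" for n
    using integrable_mult_indicator[OF A_sets integrable_drift[OF f, of n]] by (simp add: a_def)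
  have cons [measurable]: "(\<lambda>(s, \<omega>). case_nat s \<omega>) \<in> measurable (M \<Otimes>\<^sub>M S) S"
    by (simp add: case_prod_beta) measurable
  have snd_S: "distr (M \<Otimes>\<^sub>M S) S snd = S"
  proof (rule measure_eqI)
    fix B assume B: "B \<in> sets (distr (M \<Otimes>\<^sub>M S) S snd)"
    then have B': "B \<in> sets S" by simp
    have "snd -` B \<inter> space (M \<Otimes>\<^sub>M S) = space M \<times> B"
      using sets.sets_into_space[OF B'] by (auto simp: space_pair_measure)
    then show "emeasure (distr (M \<Otimes>\<^sub>M S) S snd) B = emeasure S B"
      using B' by (subst emeasure_distr) (auto simp: P.emeasure_pair_measure_Times M.emeasure_space_1)
  qed simp
  have nonneg: "0 \<le> (\<integral>p. a (snd p) * max (- drift f n (snd p)) (f (fst p)) \<partial>(M \<Otimes>\<^sub>M S))" for n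
  proof -
    have i1: "integrable (M \<Otimes>\<^sub>M S) (\<lambda>p. a (case_prod case_nat p) * drift f (Suc n) (case_prod case_nat p))"
      using int_a[of "Suc n"] PiM_iter cons
      by (subst integrable_distr_eq[OF cons, symmetric]) (auto intro: borel_measurable_times measurable_drift)
    have e1: "(\<integral>y. a y * drift f (Suc n) y \<partial>S)
        = (\<integral>p. a (case_prod case_nat p) * drift f (Suc n) (case_prod case_nat p) \<partial>(M \<Otimes>\<^sub>M S))"
      by (subst PiM_iter[symmetric], subst integral_distr[OF cons]) (auto simp del: drift.simps)
    have i2: "integrable (M \<Otimes>\<^sub>M S) (\<lambda>p. a (snd p) * drift f n (snd p))"
      using int_a[of n] snd_S
      by (subst integrable_distr_eq[OF measurable_snd, symmetric]) auto
    have e2: "(\<integral>y. a y * drift f n y \<partial>S) = (\<integral>p. a (snd p) * drift f n (snd p) \<partial>(M \<Otimes>\<^sub>M S))"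
      by (subst snd_S[symmetric], subst integral_distr[OF measurable_snd]) auto
    have "0 \<le> (\<integral>y. a y * drift f (Suc n) y \<partial>S) - (\<integral>y. a y * drift f n y \<partial>S)"
      using int_a[of n] int_a[of "Suc n"] a01 drift_mono[of f n]
      by (auto intro!: integral_mono mult_left_mono simp del: drift.simps)
    also have "\<dots> = (\<integral>p. a (case_prod case_nat p) * drift f (Suc n) (case_prod case_nat p)
         - a (snd p) * drift f n (snd p) \<partial>(M \<Otimes>\<^sub>M S))"
      unfolding e1 e2 using i1 i2 by (rule Bochner_Integration.integral_diff[symmetric])
    \<comment> \<open>The factor \<open>a\<close> ignores the prepended coordinate, and
      \<open>max 0 (t + d) - d = max (- d) t\<close>.\<close>
    also have "\<dots> = (\<integral>p. a (snd p) * max (- drift f n (snd p)) (f (fst p)) \<partial>(M \<Otimes>\<^sub>M S))"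
    proof (rule Bochner_Integration.integral_cong[OF refl])
      fix p assume p: "p \<in> space (M \<Otimes>\<^sub>M S)"
      obtain x y where xy: "p = (x, y)" by force
      have "a (case_nat x y) = a y" using A_cons p by (simp add: xy space_pair_measure a_def indicator_def)
      then show "a (case_prod case_nat p) * drift f (Suc n) (case_prod case_nat p) - a (snd p) * drift f n (snd p)
        = a (snd p) * max (- drift f n (snd p)) (f (fst p))"
        unfolding xy by (simp add: max_def algebra_simps)
    qed
    finally show ?thesis .
  qed
  have fst_M: "integrable (M \<Otimes>\<^sub>M S) (\<lambda>p. f (fst p))"
    using f distr_pair_fst[of M]
    by (subst integrable_distr_eq[OF measurable_fst, symmetric]) auto
  have "(\<lambda>n. \<integral>p. a (snd p) * max (- drift f n (snd p)) (f (fst p)) \<partial>(M \<Otimes>\<^sub>M S))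
     \<longlonglongrightarrow> (\<integral>p. a (snd p) * f (fst p) \<partial>(M \<Otimes>\<^sub>M S))"
  proof (rule integral_dominated_convergence)
    show "integrable (M \<Otimes>\<^sub>M S) (\<lambda>p. \<bar>f (fst p)\<bar>)" using fst_M by simp
    show "AE p in M \<Otimes>\<^sub>M S. (\<lambda>n. a (snd p) * max (- drift f n (snd p)) (f (fst p))) \<longlonglongrightarrow> a (snd p) * f (fst p)"
    proof (rule AE_I2)
      fix p
      \<comment> \<open>On \<open>A\<close> the drift eventually exceeds \<open>- f (fst p)\<close>,
        so the maximum is eventually equal to \<open>f (fst p)\<close>; off \<open>A\<close> the
        factor \<open>a\<close> vanishes.\<close>
      have "\<forall>\<^sub>F n in sequentially. a (snd p) * max (- drift f n (snd p)) (f (fst p)) = a (snd p) * f (fst p)"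
      proof (cases "snd p \<in> A")
        case True
        obtain m :: nat where m: "real m \<ge> - f (fst p)" using real_arch_simple by blast
        from True obtain k where k: "drift f k (snd p) > real m" by (auto simp: A_def)
        have "max (- drift f n (snd p)) (f (fst p)) = f (fst p)" if "n \<ge> k" for n
          using incseqD[OF incseq_drift that, of f "snd p"] k m by auto
        then show ?thesis by (auto simp: eventually_sequentially)
      qed (simp add: a_def)
      then show "(\<lambda>n. a (snd p) * max (- drift f n (snd p)) (f (fst p))) \<longlonglongrightarrow> a (snd p) * f (fst p)"
        by (rule tendsto_eventually)
    qed
    show "AE p in M \<Otimes>\<^sub>M S. norm (a (snd p) * max (- drift f n (snd p)) (f (fst p))) \<le> \<bar>f (fst p)\<bar>" for n
    proof (rule AE_I2)
      fix p :: "'a \<times> (nat \<Rightarrow> 'a)"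
      \<comment> \<open>Since the drift is nonnegative, the maximum equals \<open>f (fst p)\<close>
        if that is nonnegative, and otherwise lies between it and 0.\<close>
      have "\<bar>max (- drift f n (snd p)) (f (fst p))\<bar> \<le> \<bar>f (fst p)\<bar>"
        using drift_nonneg[of f n "snd p"] by (auto simp: max_def)
      then show "norm (a (snd p) * max (- drift f n (snd p)) (f (fst p))) \<le> \<bar>f (fst p)\<bar>"
        by (auto simp: a_def indicator_def)
    qed
  qed measurable
  note lim = this
  have af: "integrable (M \<Otimes>\<^sub>M S) (\<lambda>p. a (snd p) * f (fst p))"
    by (rule Bochner_Integration.integrable_bound[OF fst_M]) (auto simp: a_def indicator_def)
  from lim have "0 \<le> (\<integral>p. a (snd p) * f (fst p) \<partial>(M \<Otimes>\<^sub>M S))"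
    by (rule LIMSEQ_le_const) (use nonneg in auto)
  \<comment> \<open>The coordinates are independent, so the integral factors. With a negative mean,
    a nonnegative product forces \<open>A\<close> to be null.\<close>
  also have "\<dots> = (\<integral>x. f x \<partial>M) * measure S A"
    using af by (subst Q.integral_fst'[symmetric]) (auto simp: a_def mult.commute)
  finally have "measure S A \<le> 0" using neg by (simp add: zero_le_mult_iff)
  then have "measure S A = 0" by (simp add: measure_le_0_iff)
  then have "A \<in> null_sets S" by (auto simp: P.emeasure_eq_measure)
  then have "AE y in S. y \<notin> A" by (rule AE_not_in)
  then show ?thesis by (rule AE_mp) (auto intro!: AE_I2 simp: A_def unb[symmetric] simp flip: not_all)
qed

end

section \<open>From bounded drift to convergence of averages\<close>

context sequence_space
begin

text \<open>After subtraction of the mean plus \<open>e / 2\<close> the increments have negative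
  expectation. Their partial sums are then bounded above by a random constant, which disappears on
  division by \<open>n\<close>.\<close>

lemma AE_eventually_mean_less:
  assumes f: "integrable M f" and e: "e > 0"
  shows "AE y in S. \<forall>\<^sub>F n in sequentially. (\<Sum>i<n. f (y i)) / real n < (\<integral>x. f x \<partial>M) + e"
proof -
  let ?a = "(\<integral>x. f x \<partial>M) + e / 2"
  have "integrable M (\<lambda>x. f x - ?a)" using f by (intro Bochner_Integration.integrable_diff) auto
  moreover have "(\<integral>x. f x - ?a \<partial>M) < 0"
    using f e by (subst Bochner_Integration.integral_diff) (auto simp: M.prob_space)
  ultimately have "AE y in S. bdd_above (range (\<lambda>n. drift (\<lambda>x. f x - ?a) n y))"
    by (rule AE_bdd_above_drift)
  then show ?thesis
  proof eventually_elim
    case (elim y)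
    then obtain b where b: "\<And>n. drift (\<lambda>x. f x - ?a) n y \<le> b" by (auto simp: bdd_above_def)
    have le: "(\<Sum>i<n. f (y i)) \<le> b + real n * ?a" for n
      using sum_le_drift[of "\<lambda>x. f x - ?a" y n] b[of n] by (simp add: sum_subtractf)
    have "((\<lambda>n. b / real n) \<longlongrightarrow> 0) sequentially" by (rule lim_const_over_n)
    then have "\<forall>\<^sub>F n in sequentially. b / real n < e / 2"
      by (rule order_tendstoD) (use e in auto)
    with eventually_gt_at_top[of 0] show ?case
    proof eventually_elim
      case (elim n)
      have "(\<Sum>i<n. f (y i)) / real n \<le> (b + real n * ?a) / real n"
        by (rule divide_right_mono[OF le]) simp
      also have "\<dots> = b / real n + ?a" using elim by (simp add: field_simps)
      also have "\<dots> < (\<integral>x. f x \<partial>M) + e" using elim by linarith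
      finally show ?case .
    qed
  qed
qed

text \<open>The one-sided bound is applied to \<open>f\<close> and to \<open>- f\<close>; the
  countably many tolerances \<open>1 / real (Suc m)\<close> leave a single exceptional null
  set.\<close>

theorem strong_law_of_large_numbers:
  assumes f: "integrable M f"
  shows "AE y in S. (\<lambda>n. (\<Sum>i<n. f (y i)) / real n) \<longlonglongrightarrow> (\<integral>x. f x \<partial>M)"
proof -
  have "AE y in S. \<forall>m. (\<forall>\<^sub>F n in sequentially. (\<Sum>i<n. f (y i)) / real n < (\<integral>x. f x \<partial>M) + 1 / real (Suc m)) \<and>
      (\<forall>\<^sub>F n in sequentially. (\<Sum>i<n. - f (y i)) / real n < (\<integral>x. - f x \<partial>M) + 1 / real (Suc m))"
    using f by (subst AE_all_countable) (intro allI AE_conjI AE_eventually_mean_less, auto)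
  then show ?thesis
  proof eventually_elim
    case (elim y)
    show ?case
    proof (rule tendstoI)
      fix e :: real assume "e > 0"
      then obtain m where m: "1 / real (Suc m) < e" using nat_approx_posE by blast
      from elim[rule_format, of m] have
        "\<forall>\<^sub>F n in sequentially. (\<Sum>i<n. f (y i)) / real n < (\<integral>x. f x \<partial>M) + 1 / real (Suc m)"
        "\<forall>\<^sub>F n in sequentially. (\<Sum>i<n. - f (y i)) / real n < (\<integral>x. - f x \<partial>M) + 1 / real (Suc m)" by auto
      then show "\<forall>\<^sub>F n in sequentially. dist ((\<Sum>i<n. f (y i)) / real n) (\<integral>x. f x \<partial>M) < e"
        by eventually_elim (use m in \<open>auto simp: dist_real_def sum_negf abs_less_iff\<close>)
    qed
  qed
qed

end

section \<open>Sample averages of random functions\<close>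

locale iid_sample = prob_space M for M :: "'w measure" +
  fixes zt :: "'w \<Rightarrow> 'z::topological_space" and zs :: "nat \<Rightarrow> 'w \<Rightarrow> 'z" and \<Xi> :: "'z set"
  assumes zt_measurable: "zt \<in> borel_measurable M" and zt_space: "zt \<in> space M \<rightarrow> \<Xi>"
    and zs_space: "\<And>s. s \<ge> 1 \<Longrightarrow> zs s \<in> space M \<rightarrow> \<Xi>"
    and zs_distr: "\<And>s. s \<ge> 1 \<Longrightarrow> distr M borel (zs s) = distr M borel zt"
    and zs_indep: "indep_vars (\<lambda>_. borel) zs {1..}"
begin

definition emean :: "nat \<Rightarrow> 'w \<Rightarrow> ('z \<Rightarrow> real) \<Rightarrow> real" where
  "emean n \<omega> f = (1 / real n) * (\<Sum>s=1..n. f (zs s \<omega>))"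

abbreviation R :: "'z measure" where "R \<equiv> restrict_space borel \<Xi>"

lemma zt_measurable_R: "zt \<in> measurable M R"
  using zt_space zt_measurable by (rule measurable_restrict_space2)

lemma zs_measurable: "s \<ge> 1 \<Longrightarrow> zs s \<in> borel_measurable M"
  using zs_indep by (auto simp: indep_vars_def)

lemma zs_measurable_R: "s \<ge> 1 \<Longrightarrow> zs s \<in> measurable M R"
  using zs_space zs_measurable by (rule measurable_restrict_space2)

text \<open>Both variables take values in \<open>\<Xi>\<close>, so a trace set
  \<open>\<Xi> \<inter> C\<close> and the Borel set \<open>C\<close> have the same preimage. Passing
  to \<open>R\<close> matters because integrands are measurable only with respect to the
  trace.\<close>

lemma distr_zs_R:
  assumes "s \<ge> 1"
  shows "distr M R (zs s) = distr M R zt"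
proof (rule measure_eqI)
  fix A assume "A \<in> sets (distr M R (zs s))"
  then have A: "A \<in> sets R" by simp
  then obtain C where C: "C \<in> sets borel" "A = \<Xi> \<inter> C" by (auto simp: sets_restrict_space)
  have "emeasure M (Y -` A \<inter> space M) = emeasure (distr M borel Y) C"
    if "Y \<in> borel_measurable M" "Y \<in> space M \<rightarrow> \<Xi>" for Y
    using that C by (subst emeasure_distr) (auto intro!: arg_cong[where f="emeasure M"])
  from this[of zt] this[of "zs s"] show "emeasure (distr M R (zs s)) A = emeasure (distr M R zt) A"
    using A assms zs_distr[OF assms] zs_measurable zs_space zt_measurable zt_space
    by (simp add: emeasure_distr zt_measurable_R zs_measurable_R)
qed simp

text \<open>Samples are numbered from 1, coordinates of the sequence space from 0. Independence
  carries over because every event generated by \<open>zs (Suc i)\<close> over \<open>R\<close> is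
  also generated over the Borel sets.\<close>

lemma indep_vars_shift: "indep_vars (\<lambda>_. R) (\<lambda>i. zs (Suc i)) UNIV"
  unfolding indep_vars_def2
proof safe
  show "random_variable R (zs (Suc i))" for i using zs_measurable_R by simp
  let ?F = "\<lambda>s. {zs s -` A \<inter> space M |A. A \<in> sets borel}"
  let ?G = "\<lambda>i. {zs (Suc i) -` A \<inter> space M |A. A \<in> sets R}"
  have ind: "indep_sets ?F {1..}" using zs_indep by (simp add: indep_vars_def2)
  have GF: "?G i \<subseteq> ?F (Suc i)" for i
  proof
    fix B assume "B \<in> ?G i"
    then obtain C where C: "C \<in> sets borel" "B = zs (Suc i) -` (\<Xi> \<inter> C) \<inter> space M"
      by (auto simp: sets_restrict_space)
    then have "B = zs (Suc i) -` C \<inter> space M" using zs_space[of "Suc i"] by auto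
    with C(1) show "B \<in> ?F (Suc i)" by blast
  qed
  show "indep_sets ?G UNIV"
  proof (rule indep_setsI)
    show "?G i \<subseteq> events" for i using zs_measurable_R[of "Suc i"] by (auto intro: measurable_sets)
    fix A J assume J: "J \<noteq> {}" "finite (J :: nat set)" and A: "\<forall>j\<in>J. A j \<in> ?G j"
    have "prob (\<Inter>j\<in>Suc ` J. A (j - 1)) = (\<Prod>j\<in>Suc ` J. prob (A (j - 1)))"
    proof (intro indep_setsD[OF ind] ballI)
      fix s assume "s \<in> Suc ` J"
      then obtain j where "j \<in> J" "s = Suc j" by auto
      have "A j \<in> ?G j" using A \<open>j \<in> J\<close> by (rule bspec)
      then have "A j \<in> ?F (Suc j)" by (rule subsetD[OF GF])
      then show "A (s - 1) \<in> ?F s" unfolding \<open>s = Suc j\<close> diff_Suc_1 .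
    qed (use J in auto)
    then show "prob (\<Inter>j\<in>J. A j) = (\<Prod>j\<in>J. prob (A j))"
      by (simp add: prod.reindex)
  qed
qed

text \<open>Independence and equal laws make the joint law of the samples an infinite power of
  \<open>D\<close>. The strong law on that sequence space is pulled back along the map sending an
  outcome to its samples.\<close>

lemma AE_emean_tendsto:
  assumes f: "random_integrable M zt \<Xi> f"
  shows "AE \<omega> in M. (\<lambda>n. emean n \<omega> f) \<longlonglongrightarrow> (\<integral>\<omega>. f (zt \<omega>) \<partial>M)"
proof -
  define D where "D = distr M R zt"
  interpret D: prob_space D unfolding D_def by (rule prob_space_distr[OF zt_measurable_R])
  interpret Q: sequence_space D ..
  have fR: "f \<in> borel_measurable R" and fi: "integrable M (\<lambda>\<omega>. f (zt \<omega>))"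
    using f by (auto simp: random_integrable_def)
  have "integrable D f" unfolding D_def using fR fi by (subst integrable_distr_eq[OF zt_measurable_R]) auto
  from Q.strong_law_of_large_numbers[OF this]
  have *: "AE y in PiM UNIV (\<lambda>_. D). (\<lambda>n. (\<Sum>i<n. f (y i)) / real n) \<longlonglongrightarrow> (\<integral>x. f x \<partial>D)" .
  have I: "(\<integral>x. f x \<partial>D) = (\<integral>\<omega>. f (zt \<omega>) \<partial>M)"
    unfolding D_def by (rule integral_distr[OF zt_measurable_R fR])
  have "distr M (PiM UNIV (\<lambda>_. R)) (\<lambda>\<omega>. \<lambda>i\<in>UNIV. zs (Suc i) \<omega>) = PiM UNIV (\<lambda>i. distr M R (zs (Suc i)))"
    using indep_vars_shift zs_measurable_R by (subst indep_vars_iff_distr_eq_PiM[symmetric]) auto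
  also have "\<dots> = PiM UNIV (\<lambda>_. D)" by (simp add: distr_zs_R D_def)
  finally have d: "distr M (PiM UNIV (\<lambda>_. R)) (\<lambda>\<omega> i. zs (Suc i) \<omega>) = PiM UNIV (\<lambda>_. D)"
    by (simp add: restrict_UNIV)
  have m: "(\<lambda>\<omega> i. zs (Suc i) \<omega>) \<in> measurable M (PiM UNIV (\<lambda>_. R))"
    using measurable_restrict[of UNIV "\<lambda>i. zs (Suc i)" M "\<lambda>_. R"] zs_measurable_R
    by (simp add: restrict_UNIV)
  have "AE \<omega> in M. (\<lambda>n. (\<Sum>i<n. f (zs (Suc i) \<omega>)) / real n) \<longlonglongrightarrow> (\<integral>x. f x \<partial>D)"
    using AE_distrD[OF m] * unfolding d by blast
  moreover have "emean n \<omega> f = (\<Sum>i<n. f (zs (Suc i) \<omega>)) / real n" for n \<omega>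
    by (simp add: emean_def sum.atLeast1_atMost_eq)
  ultimately show ?thesis by (simp add: I)
qed

lemma AE_zs_in:
  assumes C: "C \<in> sets R" "measure M {\<omega> \<in> space M. zt \<omega> \<in> C} = 1"
  shows "AE \<omega> in M. \<forall>s\<ge>1. zs s \<omega> \<in> C"
proof -
  have "AE \<omega> in M. zs s \<omega> \<in> C" if s: "s \<ge> 1" for s
  proof -
    have eq: "{\<omega> \<in> space M. zs s \<omega> \<in> C} = zs s -` C \<inter> space M"
      "{\<omega> \<in> space M. zt \<omega> \<in> C} = zt -` C \<inter> space M" by auto
    have "prob {\<omega> \<in> space M. zs s \<omega> \<in> C} = measure (distr M R (zs s)) C"
      unfolding eq using C zs_measurable_R[OF s] by (subst measure_distr) auto
    also have "\<dots> = prob {\<omega> \<in> space M. zt \<omega> \<in> C}"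
      unfolding eq distr_zs_R[OF s] using C zt_measurable_R by (subst measure_distr) auto
    finally have "prob {\<omega> \<in> space M. zs s \<omega> \<in> C} = 1" using C by simp
    then show ?thesis by (rule AE_prob_1[THEN AE_mp]) auto
  qed
  then show ?thesis by (simp add: AE_all_countable)
qed

end

section \<open>Locally uniform one-sided laws of large numbers\<close>

context iid_sample
begin

lemma emean_mono:
  "(\<And>s. s \<ge> 1 \<Longrightarrow> f (zs s \<omega>) \<le> g (zs s \<omega>)) \<Longrightarrow> emean n \<omega> f \<le> emean n \<omega> g"
  unfolding emean_def by (intro mult_left_mono sum_mono) auto

lemma AE_emean_sup_less:
  fixes h :: "'p::second_countable_topology \<Rightarrow> 'z \<Rightarrow> real"
  assumes meas: "random_usc_measurable \<Xi> S h"
    and int: "\<And>p. p \<in> S \<Longrightarrow> integrable M (\<lambda>\<omega>. h p (zt \<omega>))"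
    and B: "random_integrable M zt \<Xi> B" "\<And>z p. z \<in> \<Xi> \<Longrightarrow> p \<in> S \<Longrightarrow> h p z \<le> B z"
    and usc: "\<And>z. z \<in> \<Xi> \<Longrightarrow> usc_on S (\<lambda>p. h p z)"
  shows "AE \<omega> in M. \<forall>p\<in>S. \<forall>a>\<integral>\<omega>. h p (zt \<omega>) \<partial>M. \<exists>U. open U \<and> p \<in> U \<and>
    (\<forall>\<^sub>F n in sequentially. \<forall>q\<in>S \<inter> U. emean n \<omega> (h q) < a)"
proof -
  text \<open>The suprema \<open>s U\<close> over basic neighbourhoods \<open>U\<close> of \<open>p\<close> decrease to \<open>h p\<close>, so some \<open>s U\<close> has
    expectation below \<open>a\<close>; the law of large numbers is applied to the countably many \<open>s U\<close>.\<close>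
  define s where "s U z = real_of_ereal (SUP p\<in>S \<inter> U. ereal (h p z))" for U z
  have s_ereal: "ereal (s U z) = (SUP p\<in>S \<inter> U. ereal (h p z))" if "z \<in> \<Xi>" "p \<in> S \<inter> U" for U z p
  proof -
    define e where "e = (SUP p\<in>S \<inter> U. ereal (h p z))"
    have "ereal (h p z) \<le> e" unfolding e_def using that by (intro SUP_upper)
    moreover have "e \<le> ereal (B z)" unfolding e_def using that B(2) by (intro SUP_least) auto
    ultimately have "ereal (real_of_ereal e) = e" by (cases e) auto
    then show ?thesis by (simp only: s_def e_def)
  qed
  have s_upper: "h p z \<le> s U z" if "z \<in> \<Xi>" "p \<in> S \<inter> U" for U z p
    using SUP_upper[OF that(2), of "\<lambda>p. ereal (h p z)"] unfolding s_ereal[OF that, symmetric] by simp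
  have s_least: "s U z \<le> b" if "z \<in> \<Xi>" "p \<in> S \<inter> U" "\<And>q. q \<in> S \<inter> U \<Longrightarrow> h q z \<le> b" for U z p b
    using SUP_least[of "S \<inter> U" "\<lambda>p. ereal (h p z)" "ereal b"] that(3)
    unfolding s_ereal[OF that(1,2), symmetric] by simp
  have s_mono: "s U z \<le> s V z" if "z \<in> \<Xi>" "p \<in> S \<inter> U" "U \<subseteq> V" for U V z p
    using that by (intro s_least[OF that(1,2)] s_upper) auto
  have s_meas: "s U \<in> borel_measurable R" if "open U" for U
    using meas that unfolding random_usc_measurable_def s_def by (intro borel_measurable_real_of_ereal) auto
  have zt_in: "\<omega> \<in> space M \<Longrightarrow> zt \<omega> \<in> \<Xi>" for \<omega> using zt_space by auto
  have int_B: "integrable M (\<lambda>\<omega>. B (zt \<omega>))" using B(1) by (simp add: random_integrable_def)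
  have s_meas_M: "(\<lambda>\<omega>. s U (zt \<omega>)) \<in> borel_measurable M" if "open U" for U
    by (rule measurable_compose[OF zt_measurable_R s_meas[OF that]])
  have s_abs: "\<bar>s U z\<bar> \<le> \<bar>h p z\<bar> + \<bar>B z\<bar>" if "z \<in> \<Xi>" "p \<in> S \<inter> U" for U z p
    using s_upper[OF that] s_least[OF that, of "B z"] B(2) that by fastforce
  have s_int: "integrable M (\<lambda>\<omega>. s U (zt \<omega>))" if "open U" "p \<in> S \<inter> U" for U p
  proof (rule Bochner_Integration.integrable_bound)
    show "integrable M (\<lambda>\<omega>. \<bar>h p (zt \<omega>)\<bar> + \<bar>B (zt \<omega>)\<bar>)" using int int_B that by auto
    show "AE \<omega> in M. norm (s U (zt \<omega>)) \<le> norm (\<bar>h p (zt \<omega>)\<bar> + \<bar>B (zt \<omega>)\<bar>)"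
      using s_abs[OF zt_in that(2)] by (auto intro!: AE_I2)
  qed (rule s_meas_M[OF that(1)])
  have small: "\<exists>V. open V \<and> p \<in> V \<and> (\<integral>\<omega>. s V (zt \<omega>) \<partial>M) < a"
    if p: "p \<in> S" and a: "a > (\<integral>\<omega>. h p (zt \<omega>) \<partial>M)" for p a
  proof -
    from countable_basis_at_decseq[of p] obtain A where A: "\<And>i. open (A i)" "\<And>i. p \<in> A i"
      "\<And>V. open V \<Longrightarrow> p \<in> V \<Longrightarrow> \<forall>\<^sub>F i in sequentially. A i \<subseteq> V" by metis
    have "(\<lambda>i. \<integral>\<omega>. s (A i) (zt \<omega>) \<partial>M) \<longlonglongrightarrow> (\<integral>\<omega>. h p (zt \<omega>) \<partial>M)"
    proof (rule integral_dominated_convergence)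
      show "integrable M (\<lambda>\<omega>. \<bar>h p (zt \<omega>)\<bar> + \<bar>B (zt \<omega>)\<bar>)" using int int_B p by auto
      show "AE \<omega> in M. norm (s (A i) (zt \<omega>)) \<le> \<bar>h p (zt \<omega>)\<bar> + \<bar>B (zt \<omega>)\<bar>" for i
        using s_abs[OF zt_in] A p by (auto intro!: AE_I2)
      show "AE \<omega> in M. (\<lambda>i. s (A i) (zt \<omega>)) \<longlonglongrightarrow> h p (zt \<omega>)"
      proof (rule AE_I2)
        fix \<omega> assume "\<omega> \<in> space M"
        then have z: "zt \<omega> \<in> \<Xi>" by (rule zt_in)
        show "(\<lambda>i. s (A i) (zt \<omega>)) \<longlonglongrightarrow> h p (zt \<omega>)"
        proof (rule order_tendstoI)
          fix b assume "b < h p (zt \<omega>)"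
          then show "\<forall>\<^sub>F i in sequentially. b < s (A i) (zt \<omega>)"
            using s_upper[OF z, of p] A(2) p
            by (intro always_eventually allI) (auto intro: less_le_trans)
        next
          fix b assume "h p (zt \<omega>) < b"
          \<comment> \<open>A supremum of values below a bound need not be strictly below it; the
            intermediate \<open>b'\<close> restores strictness.\<close>
          then obtain b' where b': "h p (zt \<omega>) < b'" "b' < b" using dense by blast
          from usc[OF z] p b'(1) have "\<forall>\<^sub>F q in at p within S. h q (zt \<omega>) < b'"
            by (auto simp: usc_on_def)
          then obtain V where V: "open V" "p \<in> V" "\<And>q. q \<in> V \<Longrightarrow> q \<noteq> p \<Longrightarrow> q \<in> S \<Longrightarrow> h q (zt \<omega>) < b'"
            by (auto simp: eventually_at_topological)
          from A(3)[OF V(1,2)] show "\<forall>\<^sub>F i in sequentially. s (A i) (zt \<omega>) < b"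
          proof eventually_elim
            case (elim i)
            have "h q (zt \<omega>) \<le> b'" if "q \<in> S \<inter> A i" for q
              using V(3)[of q] b'(1) that elim by (cases "q = p") auto
            then have "s (A i) (zt \<omega>) \<le> b'" using A(2) p by (intro s_least[OF z, of p]) auto
            then show ?case using b'(2) by simp
          qed
        qed
      qed
      show "(\<lambda>\<omega>. h p (zt \<omega>)) \<in> borel_measurable M" using int[OF p] by auto
    qed (rule s_meas_M[OF A(1)])
    then have "\<forall>\<^sub>F i in sequentially. (\<integral>\<omega>. s (A i) (zt \<omega>) \<partial>M) < a" by (rule order_tendstoD) (rule a)
    then show ?thesis using A(1,2) by (auto simp: eventually_sequentially)
  qed
  obtain \<B> :: "'p set set" where \<B>: "countable \<B>" "topological_basis \<B>"
    using ex_countable_basis by blast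
  have "AE \<omega> in M. \<forall>U\<in>\<B>. S \<inter> U \<noteq> {} \<longrightarrow> (\<lambda>n. emean n \<omega> (s U)) \<longlonglongrightarrow> (\<integral>\<omega>. s U (zt \<omega>) \<partial>M)"
  proof (subst AE_ball_countable[OF \<B>(1)], intro ballI AE_impI)
    fix U assume U: "U \<in> \<B>" "S \<inter> U \<noteq> {}"
    have "open U" using \<B> U(1) by (simp add: topological_basis_open)
    then have "random_integrable M zt \<Xi> (s U)"
      using s_int s_meas U(2) by (auto simp: random_integrable_def)
    then show "AE \<omega> in M. (\<lambda>n. emean n \<omega> (s U)) \<longlonglongrightarrow> (\<integral>\<omega>. s U (zt \<omega>) \<partial>M)" by (rule AE_emean_tendsto)
  qed
  with AE_space show ?thesis
  proof eventually_elim
    case (elim \<omega>)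
    show ?case
    proof (intro ballI allI impI)
      fix p a assume p: "p \<in> S" and a: "(\<integral>\<omega>. h p (zt \<omega>) \<partial>M) < a"
      from small[OF this] obtain V where V: "open V" "p \<in> V" "(\<integral>\<omega>. s V (zt \<omega>) \<partial>M) < a" by blast
      from topological_basisE[OF \<B>(2) V(1,2)] obtain U where U: "U \<in> \<B>" "p \<in> U" "U \<subseteq> V" by blast
      have oU: "open U" using \<B>(2) U(1) by (rule topological_basis_open)
      \<comment> \<open>Shrinking \<open>V\<close> to a basic set \<open>U\<close>, for which the
        law of large numbers is known, can only lower the expected supremum.\<close>
      have "(\<integral>\<omega>. s U (zt \<omega>) \<partial>M) \<le> (\<integral>\<omega>. s V (zt \<omega>) \<partial>M)"
        using p U V oU by (intro integral_mono s_int[of _ p] s_mono[OF zt_in, of _ p]) auto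
      with V(3) have "(\<integral>\<omega>. s U (zt \<omega>) \<partial>M) < a" by simp
      moreover have "(\<lambda>n. emean n \<omega> (s U)) \<longlonglongrightarrow> (\<integral>\<omega>. s U (zt \<omega>) \<partial>M)" using elim(2) U p by auto
      ultimately have "\<forall>\<^sub>F n in sequentially. emean n \<omega> (s U) < a" by (auto dest: order_tendstoD)
      then have "\<forall>\<^sub>F n in sequentially. \<forall>q\<in>S \<inter> U. emean n \<omega> (h q) < a"
      proof eventually_elim
        case el: (elim n)
        have "emean n \<omega> (h q) \<le> emean n \<omega> (s U)" if "q \<in> S \<inter> U" for q
          using that zs_space elim(1) by (intro emean_mono s_upper) auto
        with el show ?case by (auto intro: le_less_trans)
      qed
      with oU U(2) show "\<exists>U. open U \<and> p \<in> U \<and> (\<forall>\<^sub>F n in sequentially. \<forall>q\<in>S \<inter> U. emean n \<omega> (h q) < a)" by blast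
    qed
  qed
qed

lemma expectation_lipschitz:
  fixes c :: "'a::real_normed_vector \<Rightarrow> 'z \<Rightarrow> real"
  assumes int: "\<And>y. y \<in> X \<Longrightarrow> random_integrable M zt \<Xi> (c y)"
    and C: "C \<in> sets R" "measure M {\<omega> \<in> space M. zt \<omega> \<in> C} = 1"
    and Lip: "random_integrable M zt \<Xi> Lip"
    and lip: "\<And>z x y. z \<in> C \<Longrightarrow> x \<in> X \<Longrightarrow> y \<in> X \<Longrightarrow> \<bar>c x z - c y z\<bar> \<le> Lip z * norm (x - y)"
    and xy: "x \<in> X" "y \<in> X"
  shows "\<bar>(\<integral>\<omega>. c x (zt \<omega>) \<partial>M) - (\<integral>\<omega>. c y (zt \<omega>) \<partial>M)\<bar> \<le> (\<integral>\<omega>. Lip (zt \<omega>) \<partial>M) * norm (x - y)"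
proof -
  have ztC: "AE \<omega> in M. zt \<omega> \<in> C" using C(2) by (rule AE_prob_1[THEN AE_mp]) auto
  have i: "integrable M (\<lambda>\<omega>. c x (zt \<omega>))" "integrable M (\<lambda>\<omega>. c y (zt \<omega>))" "integrable M (\<lambda>\<omega>. Lip (zt \<omega>))"
    using int xy Lip by (auto simp: random_integrable_def)
  have "\<bar>(\<integral>\<omega>. c x (zt \<omega>) \<partial>M) - (\<integral>\<omega>. c y (zt \<omega>) \<partial>M)\<bar> = \<bar>\<integral>\<omega>. c x (zt \<omega>) - c y (zt \<omega>) \<partial>M\<bar>" using i by simp
  also have "\<dots> \<le> (\<integral>\<omega>. \<bar>c x (zt \<omega>) - c y (zt \<omega>)\<bar> \<partial>M)" by (rule integral_abs_bound)
  also have "\<dots> \<le> (\<integral>\<omega>. Lip (zt \<omega>) * norm (x - y) \<partial>M)"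
    using i ztC by (intro integral_mono_AE) (auto elim!: eventually_mono intro: lip xy)
  finally show ?thesis by simp
qed

text \<open>Averages converge simultaneously at the points of a countable dense set. Nearby points
  are reached by the sample Lipschitz constants, whose averages converge too and are therefore
  eventually bounded.\<close>

lemma AE_emean_inf_greater:
  fixes c :: "'a::euclidean_space \<Rightarrow> 'z \<Rightarrow> real"
  assumes int: "\<And>y. y \<in> X \<Longrightarrow> random_integrable M zt \<Xi> (c y)"
    and C: "C \<in> sets R" "measure M {\<omega> \<in> space M. zt \<omega> \<in> C} = 1"
    and Lip: "random_integrable M zt \<Xi> Lip" "\<And>z. z \<in> C \<Longrightarrow> Lip z \<ge> 0"
    and lip: "\<And>z x y. z \<in> C \<Longrightarrow> x \<in> X \<Longrightarrow> y \<in> X \<Longrightarrow> \<bar>c x z - c y z\<bar> \<le> Lip z * norm (x - y)"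
  shows "AE \<omega> in M. \<forall>p\<in>X. \<forall>a<\<integral>\<omega>. c p (zt \<omega>) \<partial>M. \<exists>U. open U \<and> p \<in> U \<and>
    (\<forall>\<^sub>F n in sequentially. \<forall>q\<in>X \<inter> U. a < emean n \<omega> (c q))"
proof -
  obtain D where D: "countable D" "D \<subseteq> X" "X \<subseteq> closure D" by (rule separable)
  let ?E = "\<lambda>p. \<integral>\<omega>. c p (zt \<omega>) \<partial>M" and ?L = "\<integral>\<omega>. Lip (zt \<omega>) \<partial>M"
  have ztC: "AE \<omega> in M. zt \<omega> \<in> C" using C(2) by (rule AE_prob_1[THEN AE_mp]) auto
  have L0: "?L \<ge> 0" using ztC by (intro integral_nonneg_AE) (auto elim!: eventually_mono simp: Lip)
  have E_lip: "\<bar>?E x - ?E y\<bar> \<le> ?L * norm (x - y)" if "x \<in> X" "y \<in> X" for x y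
    using int C Lip(1) lip that by (rule expectation_lipschitz)
  have "AE \<omega> in M. \<forall>d\<in>D. (\<lambda>n. emean n \<omega> (c d)) \<longlonglongrightarrow> ?E d"
    using D int by (subst AE_ball_countable[OF D(1)]) (auto intro: AE_emean_tendsto)
  with AE_zs_in[OF C] AE_emean_tendsto[OF Lip(1)] show ?thesis
  proof eventually_elim
    case (elim \<omega>)
    show ?case
    proof (intro ballI allI impI)
      fix p a assume p: "p \<in> X" and a: "a < ?E p"
      \<comment> \<open>The gap is split into three losses: moving the expectation from
        \<open>p\<close> to \<open>d\<close>, sampling error at \<open>d\<close>, and moving the
        average from \<open>d\<close> to \<open>q\<close>.\<close>
      define e where "e = (?E p - a) / 3"
      have e: "e > 0" using a by (simp add: e_def)
      \<comment> \<open>The summand 1 leaves room for averages of \<open>Lip\<close> slightly above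
        their mean and keeps the denominator positive.\<close>
      define \<delta> where "\<delta> = e / (?L + 1)"
      have \<delta>: "\<delta> > 0" "(?L + 1) * \<delta> = e" using e L0 by (auto simp: \<delta>_def)
      have "p \<in> closure D" using p D by auto
      then obtain d where d: "d \<in> D" "dist d p < \<delta>" using \<delta>(1) by (auto simp: closure_approachable)
      have dX: "d \<in> X" using d D by auto
      have "?L * norm (p - d) \<le> (?L + 1) * \<delta>"
        using d(2) L0 by (intro mult_mono) (auto simp: dist_norm norm_minus_commute)
      then have Ed: "?E d \<ge> ?E p - e" using E_lip[OF p dX] \<delta>(2) by linarith
      have "\<forall>\<^sub>F n in sequentially. emean n \<omega> Lip < ?L + 1" by (rule order_tendstoD(2)[OF elim(2)]) simp
      moreover have "\<forall>\<^sub>F n in sequentially. ?E d - e < emean n \<omega> (c d)"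
        by (rule order_tendstoD(1)[OF elim(3)[rule_format, OF d(1)]]) (use e in simp)
      ultimately have "\<forall>\<^sub>F n in sequentially. \<forall>q\<in>X \<inter> ball d \<delta>. a < emean n \<omega> (c q)"
      proof eventually_elim
        case el: (elim n)
        show ?case
        proof
          fix q assume q: "q \<in> X \<inter> ball d \<delta>"
          have "emean n \<omega> (c d) \<le> emean n \<omega> (\<lambda>z. c q z + \<delta> * Lip z)"
          proof (rule emean_mono)
            fix s :: nat assume "1 \<le> s"
            then have z: "zs s \<omega> \<in> C" using elim(1) by simp
            have "\<bar>c d (zs s \<omega>) - c q (zs s \<omega>)\<bar> \<le> Lip (zs s \<omega>) * norm (d - q)"
              using lip[OF z dX] q by auto
            also have "\<dots> \<le> Lip (zs s \<omega>) * \<delta>"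
              using q Lip(2)[OF z] by (intro mult_left_mono) (auto simp: dist_norm)
            finally show "c d (zs s \<omega>) \<le> c q (zs s \<omega>) + \<delta> * Lip (zs s \<omega>)" by (simp add: algebra_simps)
          qed
          also have "\<dots> = emean n \<omega> (c q) + \<delta> * emean n \<omega> Lip"
            by (simp add: emean_def sum.distrib sum_distrib_left algebra_simps)
          also have "\<dots> \<le> emean n \<omega> (c q) + e"
            using mult_right_mono[of "emean n \<omega> Lip" "?L + 1" \<delta>] el(1) \<delta>(1)
            unfolding \<delta>(2) by (simp add: mult.commute)
          finally show "a < emean n \<omega> (c q)" using el(2) Ed by (simp add: e_def field_simps)
        qed
      qed
      moreover have "p \<in> ball d \<delta>" using d by simp
      ultimately show "\<exists>U. open U \<and> p \<in> U \<and> (\<forall>\<^sub>F n in sequentially. \<forall>q\<in>X \<inter> U. a < emean n \<omega> (c q))"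
        by (intro exI[of _ "ball d \<delta>"]) auto
    qed
  qed
qed

end

section \<open>Directional derivatives and stationarity\<close>

lemma has_dir_deriv_unique: "has_dir_deriv f x v D \<Longrightarrow> has_dir_deriv f x v D' \<Longrightarrow> D = D'"
  unfolding has_dir_deriv_def by (rule tendsto_unique) simp_all

lemma dir_deriv_eq: "has_dir_deriv f x v D \<Longrightarrow> dir_deriv f x v = D"
  unfolding dir_deriv_def by (blast intro: the_equality has_dir_deriv_unique)

lemma has_dir_deriv_dir_deriv:
  "dir_differentiable_at f x \<Longrightarrow> has_dir_deriv f x v (dir_deriv f x v)"
  unfolding dir_differentiable_at_def by (metis dir_deriv_eq)

lemma has_dir_deriv_sum:
  "(\<And>i. i \<in> I \<Longrightarrow> has_dir_deriv (f i) x v (D i)) \<Longrightarrow> has_dir_deriv (\<lambda>u. \<Sum>i\<in>I. f i u) x v (\<Sum>i\<in>I. D i)"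
  unfolding has_dir_deriv_def
  by (simp add: sum_subtractf[symmetric] sum_divide_distrib) (rule tendsto_sum)

text \<open>The points \<open>y j\<close> differ from the ray points by \<open>o(\<tau> j)\<close>,
  which a Lipschitz bound turns into a vanishing quotient. The bound is required between these pairs
  only, so that functions that are Lipschitz merely on a constraint set are covered.\<close>

lemma has_dir_deriv_along_sequence:
  fixes f :: "'a::real_normed_vector \<Rightarrow> real"
  assumes D: "has_dir_deriv f x v D"
    and \<tau>: "\<And>j. \<tau> j > 0" "\<tau> \<longlonglongrightarrow> 0"
    and y: "(\<lambda>j. (y j - x) /\<^sub>R \<tau> j) \<longlonglongrightarrow> v"
    and lip: "\<forall>\<^sub>F j in sequentially. \<bar>f (y j) - f (x + \<tau> j *\<^sub>R v)\<bar> \<le> B * norm (y j - (x + \<tau> j *\<^sub>R v))"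
  shows "(\<lambda>j. (f (y j) - f x) / \<tau> j) \<longlonglongrightarrow> D"
proof -
  have "filterlim \<tau> (at_right 0) sequentially"
    using \<tau> by (intro tendsto_imp_filterlim_at_right) auto
  then have lim: "(\<lambda>j. (f (x + \<tau> j *\<^sub>R v) - f x) / \<tau> j) \<longlonglongrightarrow> D"
    using D unfolding has_dir_deriv_def by (rule filterlim_compose[rotated])
  have 0: "(\<lambda>j. (f (y j) - f (x + \<tau> j *\<^sub>R v)) / \<tau> j) \<longlonglongrightarrow> 0"
  proof (rule Lim_null_comparison)
    show "(\<lambda>j. B * norm ((y j - x) /\<^sub>R \<tau> j - v)) \<longlonglongrightarrow> 0"
      by (intro tendsto_mult_right_zero tendsto_norm_zero LIM_zero y)
    show "\<forall>\<^sub>F j in sequentially. norm ((f (y j) - f (x + \<tau> j *\<^sub>R v)) / \<tau> j) \<le> B * norm ((y j - x) /\<^sub>R \<tau> j - v)"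
      using lip
    proof eventually_elim
      case (elim j)
      have "(y j - x) /\<^sub>R \<tau> j - v = (y j - (x + \<tau> j *\<^sub>R v)) /\<^sub>R \<tau> j"
        using \<tau>(1)[of j] by (simp add: algebra_simps)
      then have "norm ((y j - x) /\<^sub>R \<tau> j - v) = norm (y j - (x + \<tau> j *\<^sub>R v)) / \<tau> j"
        using \<tau>(1)[of j] by (simp add: divide_inverse mult.commute)
      then show ?case using elim \<tau>(1)[of j] by (simp add: divide_right_mono)
    qed
  qed
  show ?thesis using tendsto_add[OF 0 lim] by (simp add: add_divide_distrib[symmetric])
qed

lemma tendsto_of_difference_quotient:
  fixes y :: "nat \<Rightarrow> 'a::real_normed_vector"
  assumes "\<And>j. \<tau> j > 0" "\<tau> \<longlonglongrightarrow> 0" "(\<lambda>j. (y j - x) /\<^sub>R \<tau> j) \<longlonglongrightarrow> v"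
  shows "(\<lambda>j. norm (y j - x) / \<tau> j) \<longlonglongrightarrow> norm v"
proof -
  have "norm ((y j - x) /\<^sub>R \<tau> j) = norm (y j - x) / \<tau> j" for j
    using assms(1)[of j] by (simp add: divide_inverse mult.commute)
  then show ?thesis using tendsto_norm[OF assms(3)] by simp
qed

lemma b_differentiable_along_sequence:
  fixes f :: "'a::real_normed_vector \<Rightarrow> real"
  assumes f: "b_differentiable_at f x"
    and \<tau>: "\<And>j. \<tau> j > 0" "\<tau> \<longlonglongrightarrow> 0"
    and y: "y \<longlonglongrightarrow> x" "(\<lambda>j. (y j - x) /\<^sub>R \<tau> j) \<longlonglongrightarrow> v"
  shows "(\<lambda>j. (f (y j) - f x) / \<tau> j) \<longlonglongrightarrow> dir_deriv f x v"
proof -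
  from f obtain e B where e: "e > 0" and B: "B-lipschitz_on (ball x e) f"
    and dd: "dir_differentiable_at f x" by (auto simp: b_differentiable_at_def)
  have "(\<lambda>j. x + \<tau> j *\<^sub>R v) \<longlonglongrightarrow> x + 0 *\<^sub>R v" using \<tau>(2) by (intro tendsto_intros)
  then have "(\<lambda>j. x + \<tau> j *\<^sub>R v) \<longlonglongrightarrow> x" by simp
  then have "\<forall>\<^sub>F j in sequentially. x + \<tau> j *\<^sub>R v \<in> ball x e"
    by (rule topological_tendstoD[OF _ open_ball]) (simp add: e)
  moreover have "\<forall>\<^sub>F j in sequentially. y j \<in> ball x e"
    by (rule topological_tendstoD[OF y(1) open_ball]) (simp add: e)
  ultimately have "\<forall>\<^sub>F j in sequentially. \<bar>f (y j) - f (x + \<tau> j *\<^sub>R v)\<bar> \<le> B * norm (y j - (x + \<tau> j *\<^sub>R v))"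
  proof eventually_elim
    case (elim j)
    then show ?case using lipschitz_onD[OF B elim(2,1)] by (simp add: dist_norm)
  qed
  then show ?thesis by (rule has_dir_deriv_along_sequence[OF has_dir_deriv_dir_deriv[OF dd] \<tau> y(2)])
qed

lemma b_stationary_if_quadratic_lower_bound:
  fixes f :: "'a::real_normed_vector \<Rightarrow> real"
  assumes f: "b_differentiable_at f x" and x: "x \<in> C" and e: "e > 0"
    and lb: "\<And>u. u \<in> C \<Longrightarrow> u \<in> ball x e \<Longrightarrow> f x \<le> f u + r * (norm (u - x))\<^sup>2"
  shows "b_stationary f C x"
  unfolding b_stationary_def
proof (intro conjI ballI x)
  fix v assume "v \<in> tangent_cone x C"
  then obtain y \<tau> where y: "\<And>j::nat. y j \<in> C" and \<tau>: "\<And>j. \<tau> j > 0"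
    and lim: "y \<longlonglongrightarrow> x" "\<tau> \<longlonglongrightarrow> 0" "(\<lambda>j. (y j - x) /\<^sub>R \<tau> j) \<longlonglongrightarrow> v"
    by (auto simp: tangent_cone_def)
  have A: "(\<lambda>j. (f (y j) - f x) / \<tau> j) \<longlonglongrightarrow> dir_deriv f x v"
    by (rule b_differentiable_along_sequence[OF f \<tau> lim(2,1,3)])
  \<comment> \<open>The square is split so that one factor tends to 0 while the other, divided by
    \<open>\<tau> j\<close>, tends to \<open>norm v\<close>.\<close>
  have "(\<lambda>j. - r * (norm (y j - x) * (norm (y j - x) / \<tau> j))) \<longlonglongrightarrow> - r * (norm (x - x) * norm v)"
    using lim(1) by (intro tendsto_intros tendsto_of_difference_quotient[OF \<tau> lim(2,3)])
  then have B: "(\<lambda>j. - r * (norm (y j - x) * (norm (y j - x) / \<tau> j))) \<longlonglongrightarrow> 0" by simp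
  have "\<forall>\<^sub>F j in sequentially. y j \<in> ball x e"
    by (rule topological_tendstoD[OF lim(1) open_ball]) (simp add: e)
  then have "\<forall>\<^sub>F j in sequentially. - r * (norm (y j - x) * (norm (y j - x) / \<tau> j)) \<le> (f (y j) - f x) / \<tau> j"
  proof eventually_elim
    case (elim j)
    have "- r * (norm (y j - x))\<^sup>2 / \<tau> j \<le> (f (y j) - f x) / \<tau> j"
      using lb[OF y elim] \<tau>[of j] by (intro divide_right_mono) auto
    then show ?case by (simp add: power2_eq_square)
  qed
  then have "0 \<le> dir_deriv f x v" by (rule tendsto_le[OF _ A B, rotated]) simp
  moreover have "has_dir_deriv f x v (dir_deriv f x v)"
    using f by (intro has_dir_deriv_dir_deriv) (simp add: b_differentiable_at_def)
  ultimately show "\<exists>D. has_dir_deriv f x v D \<and> D \<ge> 0" by blast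
qed

section \<open>Tangent cones and transfer of stationarity\<close>

lemma tangent_cone_mono: "C \<subseteq> D \<Longrightarrow> tangent_cone x C \<subseteq> tangent_cone x D"
  unfolding tangent_cone_def by blast

lemma tangent_cone_feasible_direction:
  fixes x v :: "'a::real_normed_vector"
  assumes "\<forall>\<^sub>F t in at_right 0. x + t *\<^sub>R v \<in> C"
  shows "v \<in> tangent_cone x C"
proof -
  from assms obtain b where b: "b > 0" "\<And>t. 0 < t \<Longrightarrow> t < b \<Longrightarrow> x + t *\<^sub>R v \<in> C"
    by (auto simp: eventually_at_right_field)
  \<comment> \<open>Halving \<open>b\<close> keeps already the first step strictly below
    \<open>b\<close>.\<close>
  define \<tau> where "\<tau> j = b / 2 / real (Suc j)" for j
  have \<tau>: "0 < \<tau> j" "\<tau> j < b" for j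
    using b(1) by (auto simp: \<tau>_def field_simps intro: mult_pos_pos add_pos_nonneg)
  have lim: "\<tau> \<longlonglongrightarrow> 0" unfolding \<tau>_def by (rule LIMSEQ_Suc[OF lim_const_over_n])
  have "(\<lambda>j. x + \<tau> j *\<^sub>R v) \<longlonglongrightarrow> x + 0 *\<^sub>R v" using lim by (intro tendsto_intros)
  moreover have "(\<lambda>j. (x + \<tau> j *\<^sub>R v - x) /\<^sub>R \<tau> j) \<longlonglongrightarrow> v" using \<tau>(1) by (simp add: less_imp_neq[OF \<tau>(1), symmetric])
  ultimately show ?thesis using b \<tau> lim unfolding tangent_cone_def
    by (intro CollectI exI[of _ "\<lambda>j. x + \<tau> j *\<^sub>R v"] exI[of _ \<tau>]) auto
qed

text \<open>In a half-space active at \<open>x\<close> the tangent direction satisfies the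
  homogeneous inequality by a limit argument; an inactive one has slack for small steps. As there
  are finitely many half-spaces, one step size serves all.\<close>

lemma polyhedron_feasible_direction:
  fixes x v :: "'a::euclidean_space"
  assumes X: "polyhedron X" and x: "x \<in> X" and v: "v \<in> tangent_cone x X"
  shows "\<forall>\<^sub>F t in at_right 0. x + t *\<^sub>R v \<in> X"
proof -
  from X obtain H where H: "finite H" "X = \<Inter>H" "\<And>h. h \<in> H \<Longrightarrow> \<exists>a b. h = {y. a \<bullet> y \<le> b}"
    unfolding polyhedron_def by metis
  from v obtain y \<tau> where y: "\<And>j::nat. y j \<in> X" and \<tau>: "\<And>j. \<tau> j > 0"
    and lim: "(\<lambda>j. (y j - x) /\<^sub>R \<tau> j) \<longlonglongrightarrow> v"
    by (auto simp: tangent_cone_def)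
  have "\<forall>\<^sub>F t in at_right 0. \<forall>h\<in>H. x + t *\<^sub>R v \<in> h"
  proof (rule eventually_ball_finite[OF H(1)], rule ballI)
    fix h assume h: "h \<in> H"
    then obtain a b where ab: "h = {y. a \<bullet> y \<le> b}" using H(3) by blast
    have "x \<in> h" using x H(2) h by blast
    then have xb: "a \<bullet> x \<le> b" by (simp add: ab)
    show "\<forall>\<^sub>F t in at_right 0. x + t *\<^sub>R v \<in> h"
    proof (cases "a \<bullet> x = b")
      case True
      have "a \<bullet> ((y j - x) /\<^sub>R \<tau> j) \<le> 0" for j
      proof -
        have "y j \<in> h" using y[of j] H(2) h by blast
        then have "a \<bullet> (y j - x) \<le> 0" by (simp add: ab True inner_diff_right)
        then show ?thesis using \<tau>[of j] by (simp add: mult_nonneg_nonpos)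
      qed
      moreover have "(\<lambda>j. a \<bullet> ((y j - x) /\<^sub>R \<tau> j)) \<longlonglongrightarrow> a \<bullet> v" using lim by (intro tendsto_intros)
      ultimately have "a \<bullet> v \<le> 0" by (intro LIMSEQ_le_const2) auto
      then show ?thesis
        by (auto simp: ab eventually_at_right_field inner_add_right True mult_nonneg_nonpos intro!: exI[of _ 1])
    next
      case False
      have "((\<lambda>t. a \<bullet> (x + t *\<^sub>R v)) \<longlongrightarrow> a \<bullet> (x + 0 *\<^sub>R v)) (at_right 0)" by (intro tendsto_intros)
      then have "\<forall>\<^sub>F t in at_right 0. a \<bullet> (x + t *\<^sub>R v) < b"
        by (rule order_tendstoD) (use False xb in auto)
      then show ?thesis by eventually_elim (simp add: ab)
    qed
  qed
  then show ?thesis by (simp add: H(2))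
qed

text \<open>The directional derivative inherits, as a function of the direction, the local Lipschitz
  constant of \<open>f\<close>.\<close>

lemma dir_deriv_tendsto_direction:
  fixes f :: "'a::real_normed_vector \<Rightarrow> real"
  assumes f: "b_differentiable_at f x" and v: "(w :: nat \<Rightarrow> 'a) \<longlonglongrightarrow> v"
  shows "(\<lambda>i. dir_deriv f x (w i)) \<longlonglongrightarrow> dir_deriv f x v"
proof -
  from f obtain e B where e: "e > 0" and B: "B-lipschitz_on (ball x e) f"
    and dd: "dir_differentiable_at f x" by (auto simp: b_differentiable_at_def)
  have lip: "\<bar>dir_deriv f x u - dir_deriv f x w\<bar> \<le> B * norm (u - w)" for u w
  proof -
    have near: "\<forall>\<^sub>F t in at_right 0. x + t *\<^sub>R u \<in> ball x e" for u
    proof -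
      have "((\<lambda>t. x + t *\<^sub>R u) \<longlongrightarrow> x + 0 *\<^sub>R u) (at_right 0)" by (intro tendsto_intros)
      then show ?thesis by (rule topological_tendstoD[OF _ open_ball]) (simp add: e)
    qed
    have "((\<lambda>t. \<bar>(f (x + t *\<^sub>R u) - f x) / t - (f (x + t *\<^sub>R w) - f x) / t\<bar>)
       \<longlongrightarrow> \<bar>dir_deriv f x u - dir_deriv f x w\<bar>) (at_right 0)"
      using has_dir_deriv_dir_deriv[OF dd] unfolding has_dir_deriv_def by (intro tendsto_intros) auto
    moreover have "\<forall>\<^sub>F t in at_right 0.
       \<bar>(f (x + t *\<^sub>R u) - f x) / t - (f (x + t *\<^sub>R w) - f x) / t\<bar> \<le> B * norm (u - w)"
      using near[of u] near[of w] eventually_at_right_less[of 0]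
    proof eventually_elim
      case (elim t)
      have "\<bar>f (x + t *\<^sub>R u) - f (x + t *\<^sub>R w)\<bar> \<le> B * norm (t *\<^sub>R (u - w))"
        using lipschitz_onD[OF B elim(1,2)]
        by (simp add: dist_norm scaleR_diff_right del: norm_scaleR)
      then have "\<bar>f (x + t *\<^sub>R u) - f (x + t *\<^sub>R w)\<bar> \<le> B * (t * norm (u - w))"
        using elim(3) by (simp only: norm_scaleR abs_of_pos)
      then have "\<bar>f (x + t *\<^sub>R u) - f (x + t *\<^sub>R w)\<bar> / t \<le> B * norm (u - w)"
        using elim(3) by (simp add: field_simps)
      then show ?case using elim(3) by (simp add: diff_divide_distrib[symmetric])
    qed
    ultimately show ?thesis by (rule tendsto_upperbound) simp
  qed
  have "(\<lambda>i. B * norm (w i - v)) \<longlonglongrightarrow> 0"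
    by (intro tendsto_mult_right_zero tendsto_norm_zero LIM_zero v)
  then have "(\<lambda>i. dir_deriv f x (w i) - dir_deriv f x v) \<longlonglongrightarrow> 0"
    by (rule Lim_null_comparison[rotated]) (use lip in auto)
  then show ?thesis by (rule LIM_zero_cancel)
qed

lemma b_stationary_transfer:
  fixes X :: "'a::euclidean_space set"
  assumes X: "polyhedron X" and x: "x \<in> feasible_set X K g \<zeta>"
    and touch: "\<And>k. k \<in> {1..K} \<Longrightarrow> gh k x = g k x"
    and g_lip: "\<And>k u w. k \<in> {1..K} \<Longrightarrow> u \<in> X \<Longrightarrow> w \<in> X \<Longrightarrow> \<bar>g k u - g k w\<bar> \<le> B * norm (u - w)"
    and gh: "\<And>k. k \<in> {1..K} \<Longrightarrow> b_differentiable_at (gh k) x"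
    and g_dd: "\<And>k v. k \<in> {1..K} \<Longrightarrow> has_dir_deriv (g k) x v (dir_deriv (gh k) x v)"
    and fh: "b_differentiable_at fh x"
    and f_dd: "\<And>v. has_dir_deriv f x v (dir_deriv fh x v)"
    and stat: "b_stationary fh (feasible_set X K gh \<zeta>) x"
    and slater: "directional_slater X K g \<zeta> x"
  shows "b_stationary f (feasible_set X K g \<zeta>) x"
  unfolding b_stationary_def
  \<comment> \<open>\<open>g\<close> is Lipschitz on \<open>X\<close> only, so its directional derivatives control tangent sequences because
    tangent directions of a polyhedron are feasible directions.\<close>
proof (intro conjI ballI x)
  have xX: "x \<in> X" using x by (simp add: feasible_set_def)
  fix v assume v: "v \<in> tangent_cone x (feasible_set X K g \<zeta>)"
  have vX: "v \<in> tangent_cone x X"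
    using v tangent_cone_mono[of "feasible_set X K g \<zeta>" X] by (auto simp: feasible_set_def)
  from v obtain y \<tau> where y: "\<And>j::nat. y j \<in> feasible_set X K g \<zeta>" and \<tau>: "\<And>j. \<tau> j > 0"
    and lim: "y \<longlonglongrightarrow> x" "\<tau> \<longlonglongrightarrow> 0" "(\<lambda>j. (y j - x) /\<^sub>R \<tau> j) \<longlonglongrightarrow> v"
    by (auto simp: tangent_cone_def)
  \<comment> \<open>At an active constraint \<open>g k x = \<zeta> k\<close>, so feasibility of
    \<open>y j\<close> makes all difference quotients nonpositive.\<close>
  have "dir_deriv (g k) x v \<le> 0" if k: "k \<in> active_set K g \<zeta> x" for k
  proof -
    have k': "k \<in> {1..K}" "g k x = \<zeta> k" using k by (auto simp: active_set_def)
    have "filterlim \<tau> (at_right 0) sequentially"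
      using \<tau> lim(2) by (intro tendsto_imp_filterlim_at_right) auto
    then have "\<forall>\<^sub>F j in sequentially. x + \<tau> j *\<^sub>R v \<in> X"
      using polyhedron_feasible_direction[OF X xX vX] by (rule filterlim_iff[THEN iffD1, rule_format])
    then have "\<forall>\<^sub>F j in sequentially. \<bar>g k (y j) - g k (x + \<tau> j *\<^sub>R v)\<bar> \<le> B * norm (y j - (x + \<tau> j *\<^sub>R v))"
      by eventually_elim (use y k'(1) g_lip in \<open>auto simp: feasible_set_def\<close>)
    then have "(\<lambda>j. (g k (y j) - g k x) / \<tau> j) \<longlonglongrightarrow> dir_deriv (g k) x v"
      using has_dir_deriv_along_sequence[OF g_dd[OF k'(1)] \<tau> lim(2,3)]
        dir_deriv_eq[OF g_dd[OF k'(1)]] by auto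
    moreover have "(g k (y j) - g k x) / \<tau> j \<le> 0" for j
      using y[of j] k' \<tau>[of j] by (auto simp: feasible_set_def divide_nonpos_pos)
    ultimately show ?thesis by (intro LIMSEQ_le_const2) auto
  qed
  then have "v \<in> closure {v \<in> tangent_cone x X. \<forall>k\<in>active_set K g \<zeta> x. dir_deriv (g k) x v < 0}"
    using slater vX unfolding directional_slater_def by blast
  \<comment> \<open>The direction \<open>v\<close> itself may fail to be tangent to the feasible set
    of \<open>gh\<close>, whereas strict descent of the active constraints makes the approximating
    directions \<open>w i\<close> tangent to it.\<close>
  then obtain w where w: "\<And>i::nat. w i \<in> tangent_cone x X"
    "\<And>i k. k \<in> active_set K g \<zeta> x \<Longrightarrow> dir_deriv (g k) x (w i) < 0" and w_lim: "w \<longlonglongrightarrow> v"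
    unfolding closure_sequential by blast
  have "dir_deriv fh x (w i) \<ge> 0" for i
  proof -
    have near: "\<forall>\<^sub>F t in at_right 0. gh k (x + t *\<^sub>R w i) \<le> \<zeta> k" if k: "k \<in> {1..K}" for k
    proof -
      have "dir_differentiable_at (gh k) x" using gh[OF k] by (simp add: b_differentiable_at_def)
      then have q: "((\<lambda>t. (gh k (x + t *\<^sub>R w i) - gh k x) / t) \<longlongrightarrow> dir_deriv (gh k) x (w i)) (at_right 0)"
        by (rule has_dir_deriv_dir_deriv[unfolded has_dir_deriv_def])
      have le: "gh k x \<le> \<zeta> k" using x k touch[OF k] by (auto simp: feasible_set_def)
      show ?thesis
      proof (cases "gh k x = \<zeta> k")
        case True
        then have "k \<in> active_set K g \<zeta> x" using k touch[OF k] by (auto simp: active_set_def)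
        then have "dir_deriv (gh k) x (w i) < 0" using w(2) dir_deriv_eq[OF g_dd[OF k]] by metis
        with q have "\<forall>\<^sub>F t in at_right 0. (gh k (x + t *\<^sub>R w i) - gh k x) / t < 0" by (rule order_tendstoD)
        with eventually_at_right_less[of 0] show ?thesis
          by eventually_elim (simp add: True divide_less_0_iff)
      next
        case False
        \<comment> \<open>Multiplying the quotient by \<open>t\<close> recovers the increment, which
          tends to 0 and so stays below the slack of the inactive constraint.\<close>
        have "((\<lambda>t. t * ((gh k (x + t *\<^sub>R w i) - gh k x) / t)) \<longlongrightarrow> 0 * dir_deriv (gh k) x (w i)) (at_right 0)"
          by (intro tendsto_mult q tendsto_ident_at)
        then have "\<forall>\<^sub>F t in at_right 0. t * ((gh k (x + t *\<^sub>R w i) - gh k x) / t) < \<zeta> k - gh k x"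
          by (rule order_tendstoD) (use le False in auto)
        with eventually_at_right_less[of 0] show ?thesis by eventually_elim simp
      qed
    qed
    have "\<forall>\<^sub>F t in at_right 0. \<forall>k\<in>{1..K}. gh k (x + t *\<^sub>R w i) \<le> \<zeta> k"
      using near by (intro eventually_ball_finite) auto
    with polyhedron_feasible_direction[OF X xX w(1)[of i]]
    have "\<forall>\<^sub>F t in at_right 0. x + t *\<^sub>R w i \<in> feasible_set X K gh \<zeta>"
      by eventually_elim (simp add: feasible_set_def)
    then have "w i \<in> tangent_cone x (feasible_set X K gh \<zeta>)" by (rule tangent_cone_feasible_direction)
    then show ?thesis using stat dir_deriv_eq unfolding b_stationary_def by metis
  qed
  then have "dir_deriv fh x v \<ge> 0"
    using dir_deriv_tendsto_direction[OF fh w_lim] by (intro LIMSEQ_le_const) auto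
  then show "\<exists>D. has_dir_deriv f x v D \<and> D \<ge> 0" using f_dd by blast
qed

section \<open>Limits of penalized minimizers\<close>

text \<open>The sequences \<open>m0 j\<close>, \<open>m k j\<close> stand for the sampled surrogates along a subsequence of the
  iterations, with base points \<open>x j\<close> and minimizers \<open>x' j\<close>; \<open>F\<close> and \<open>G k\<close> are their expectations.
  Only upper bounds are available at fixed points, and only lower bounds along the minimizers.\<close>
locale penalized_minimizers =
  fixes X :: "'a::real_normed_vector set" and K :: nat and \<zeta> :: "nat \<Rightarrow> real"
    and m0 :: "nat \<Rightarrow> 'a \<Rightarrow> real" and m :: "nat \<Rightarrow> nat \<Rightarrow> 'a \<Rightarrow> real"
    and F :: "'a \<Rightarrow> real" and G :: "nat \<Rightarrow> 'a \<Rightarrow> real"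
    and x x' :: "nat \<Rightarrow> 'a" and p :: 'a and lam rho :: "nat \<Rightarrow> real" and \<iota> \<rho> :: real
  assumes opt: "\<And>j u. u \<in> X \<Longrightarrow>
      m0 j (x' j) + lam j * (\<Sum>k=1..K. max (m k j (x' j) - \<zeta> k) 0) + rho j / 2 * (norm (x' j - x j))\<^sup>2
      \<le> m0 j u + lam j * (\<Sum>k=1..K. max (m k j u - \<zeta> k) 0) + rho j / 2 * (norm (u - x j))\<^sup>2"
    and x_lim: "x \<longlonglongrightarrow> p"
    and lam: "\<And>j. lam j > 0" "(\<lambda>j. 1 / lam j) \<longlonglongrightarrow> \<iota>"
    and rho: "\<And>j. rho j > 0" "(\<lambda>j. rho j / lam j) \<longlonglongrightarrow> 0" "rho \<longlonglongrightarrow> \<rho>"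
    and low0: "\<And>a. a < F p \<Longrightarrow> \<forall>\<^sub>F j in sequentially. a < m0 j (x' j)"
    and low: "\<And>k a. k \<in> {1..K} \<Longrightarrow> a < G k p \<Longrightarrow> \<forall>\<^sub>F j in sequentially. a < m k j (x' j)"
    and up0: "\<And>u a. u \<in> X \<Longrightarrow> F u < a \<Longrightarrow> \<forall>\<^sub>F j in sequentially. m0 j u < a"
    and up: "\<And>k u a. k \<in> {1..K} \<Longrightarrow> u \<in> X \<Longrightarrow> G k u < a \<Longrightarrow> \<forall>\<^sub>F j in sequentially. m k j u < a"
begin

text \<open>If constraint \<open>k\<close> were violated by \<open>\<eta>\<close> at
  \<open>p\<close>, the penalty at the minimizers would eventually be at least
  \<open>\<eta> / 2\<close>. Divided by \<open>lam j\<close>, the optimality inequality bounds it by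
  \<open>\<iota> * (F u - F p)\<close>, which is nonpositive, plus terms that can be made
  small.\<close>

lemma limit_feasible:
  assumes u: "u \<in> feasible_set X K G \<zeta>" and le: "\<iota> * F u \<le> \<iota> * F p" and k: "k \<in> {1..K}"
  shows "G k p \<le> \<zeta> k"
proof (rule ccontr)
  assume "\<not> G k p \<le> \<zeta> k"
  define \<eta> where "\<eta> = G k p - \<zeta> k"
  have \<eta>: "\<eta> > 0" using \<open>\<not> G k p \<le> \<zeta> k\<close> by (simp add: \<eta>_def)
  have \<iota>: "\<iota> \<ge> 0" using lam by (intro LIMSEQ_le_const[OF lam(2)]) (auto simp: less_imp_le)
  have uX: "u \<in> X" and uG: "\<And>k. k \<in> {1..K} \<Longrightarrow> G k u \<le> \<zeta> k" using u by (auto simp: feasible_set_def)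
  \<comment> \<open>The term \<open>2 * \<iota>\<close> collects the errors in the two objective
    values, and \<open>real K\<close> the possible excess \<open>\<delta>\<close> of each constraint
    at \<open>u\<close>.\<close>
  have bound: "\<eta> / 2 \<le> (2 * \<iota> + real K) * \<delta>" if \<delta>: "\<delta> > 0" for \<delta>
  proof -
    have "\<forall>\<^sub>F j in sequentially. \<forall>k\<in>{1..K}. m k j u < \<zeta> k + \<delta>"
    proof (intro eventually_ball_finite ballI up)
      show "G k u < \<zeta> k + \<delta>" if "k \<in> {1..K}" for k using uG[OF that] \<delta> by simp
    qed (use uX in auto)
    moreover have "\<forall>\<^sub>F j in sequentially. m0 j u < F u + \<delta>" using uX \<delta> by (intro up0) auto
    moreover have "\<forall>\<^sub>F j in sequentially. F p - \<delta> < m0 j (x' j)" using \<delta> by (intro low0) auto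
    moreover have "\<forall>\<^sub>F j in sequentially. \<zeta> k + \<eta> / 2 < m k j (x' j)"
      using \<eta> k by (intro low) (auto simp: \<eta>_def field_simps)
    ultimately have ev: "\<forall>\<^sub>F j in sequentially. \<eta> / 2
        \<le> 1 / lam j * (F u - F p + 2 * \<delta>) + real K * \<delta> + rho j / lam j / 2 * (norm (u - x j))\<^sup>2"
    proof eventually_elim
      case (elim j)
      have "\<eta> / 2 \<le> max (m k j (x' j) - \<zeta> k) 0" using elim(4) by linarith
      also have "\<dots> \<le> (\<Sum>k=1..K. max (m k j (x' j) - \<zeta> k) 0)" using k by (intro member_le_sum) auto
      finally have "lam j * (\<eta> / 2) \<le> lam j * (\<Sum>k=1..K. max (m k j (x' j) - \<zeta> k) 0)"
        using lam(1)[of j] by (intro mult_left_mono) auto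
      moreover have "(\<Sum>k=1..K. max (m k j u - \<zeta> k) 0) \<le> (\<Sum>k=1..K. \<delta>)"
        using elim(1) \<delta> by (intro sum_mono) fastforce
      then have "lam j * (\<Sum>k=1..K. max (m k j u - \<zeta> k) 0) \<le> lam j * (real K * \<delta>)"
        using lam(1)[of j] by (intro mult_left_mono) auto
      moreover have "0 \<le> rho j / 2 * (norm (x' j - x j))\<^sup>2" using rho(1)[of j] by simp
      ultimately have "lam j * (\<eta> / 2) \<le> (F u - F p + 2 * \<delta>) + lam j * (real K * \<delta>) + rho j / 2 * (norm (u - x j))\<^sup>2"
        using opt[OF uX, of j] elim(2,3) by linarith
      then have "lam j * (\<eta> / 2) / lam j
        \<le> ((F u - F p + 2 * \<delta>) + lam j * (real K * \<delta>) + rho j / 2 * (norm (u - x j))\<^sup>2) / lam j"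
        using lam(1)[of j] by (intro divide_right_mono) auto
      then show ?case using lam(1)[of j] by (simp add: add_divide_distrib)
    qed
    have "(\<lambda>j. 1 / lam j * (F u - F p + 2 * \<delta>) + real K * \<delta> + rho j / lam j / 2 * (norm (u - x j))\<^sup>2)
        \<longlonglongrightarrow> \<iota> * (F u - F p + 2 * \<delta>) + real K * \<delta> + 0 / 2 * (norm (u - p))\<^sup>2"
      by (intro tendsto_intros lam rho x_lim) simp
    then have "\<eta> / 2 \<le> \<iota> * (F u - F p + 2 * \<delta>) + real K * \<delta> + 0 / 2 * (norm (u - p))\<^sup>2"
      using ev by (intro tendsto_lowerbound) auto
    then show ?thesis using le by (simp add: algebra_simps)
  qed
  \<comment> \<open>With \<open>\<delta> = \<eta> / (4 * d)\<close> the bound is at most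
    \<open>\<eta> / 4\<close>, contradicting \<open>\<eta> / 2\<close>.\<close>
  define d where "d = 2 * \<iota> + real K + 1"
  have d: "d > 0" using \<iota> by (simp add: d_def add_nonneg_pos)
  have "\<eta> / 2 \<le> (2 * \<iota> + real K) * (\<eta> / (4 * d))" using d \<eta> by (intro bound) simp
  also have "\<dots> \<le> d * (\<eta> / (4 * d))" using d \<eta> by (intro mult_right_mono) (auto simp: d_def)
  also have "\<dots> = \<eta> / 4" using d by simp
  finally show False using \<eta> by simp
qed

text \<open>The penalty at a strictly feasible \<open>u\<close> is eventually exactly 0, so a
  possibly unbounded factor \<open>lam j\<close> does no harm. At a point that is only feasible, a
  small sampled violation could be amplified.\<close>

lemma limit_quadratic_bound:
  assumes u: "u \<in> strictly_feasible_set X K G \<zeta>"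
  shows "F p \<le> F u + \<rho> / 2 * (norm (u - p))\<^sup>2"
proof (rule field_le_epsilon)
  fix e :: real assume e: "e > 0"
  have uX: "u \<in> X" and uG: "\<And>k. k \<in> {1..K} \<Longrightarrow> G k u < \<zeta> k" using u by (auto simp: strictly_feasible_set_def)
  have "\<forall>\<^sub>F j in sequentially. \<forall>k\<in>{1..K}. m k j u < \<zeta> k"
    using uG uX by (intro eventually_ball_finite ballI up) auto
  moreover have "\<forall>\<^sub>F j in sequentially. m0 j u < F u + e / 2" using uX e by (intro up0) auto
  moreover have "\<forall>\<^sub>F j in sequentially. F p - e / 2 < m0 j (x' j)" using e by (intro low0) auto
  ultimately have "\<forall>\<^sub>F j in sequentially. F p - e \<le> F u + rho j / 2 * (norm (u - x j))\<^sup>2"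
  proof eventually_elim
    case (elim j)
    have "0 \<le> lam j * (\<Sum>k=1..K. max (m k j (x' j) - \<zeta> k) 0)"
      using lam(1)[of j] by (intro mult_nonneg_nonneg sum_nonneg) auto
    moreover have "(\<Sum>k=1..K. max (m k j u - \<zeta> k) 0) = 0" using elim(1) by (intro sum.neutral) fastforce
    moreover have "0 \<le> rho j / 2 * (norm (x' j - x j))\<^sup>2" using rho(1)[of j] by simp
    ultimately show ?case using opt[OF uX, of j] elim(2,3) by simp
  qed
  moreover have "(\<lambda>j. F u + rho j / 2 * (norm (u - x j))\<^sup>2) \<longlonglongrightarrow> F u + \<rho> / 2 * (norm (u - p))\<^sup>2"
    by (intro tendsto_intros rho x_lim) simp
  ultimately have "F p - e \<le> F u + \<rho> / 2 * (norm (u - p))\<^sup>2" by (intro tendsto_lowerbound) auto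
  then show "F p \<le> F u + \<rho> / 2 * (norm (u - p))\<^sup>2 + e" by simp
qed

lemma limit_b_stationary:
  assumes cc: "constraint_closure X K G \<zeta>" and p: "p \<in> feasible_set X K G \<zeta>" and F: "b_differentiable_at F p"
  shows "b_stationary F (feasible_set X K G \<zeta>) p"
proof -
  from F obtain e B where e: "e > 0" and B: "B-lipschitz_on (ball p e) F"
    by (auto simp: b_differentiable_at_def)
  show ?thesis
  proof (rule b_stationary_if_quadratic_lower_bound[OF F p e])
    fix u assume u: "u \<in> feasible_set X K G \<zeta>" "u \<in> ball p e"
    have "u \<in> closure (strictly_feasible_set X K G \<zeta>)" using cc u(1) by (auto simp: constraint_closure_def)
    then obtain w where w: "\<And>n::nat. w n \<in> strictly_feasible_set X K G \<zeta>" "w \<longlonglongrightarrow> u"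
      unfolding closure_sequential by blast
    \<comment> \<open>The neighbourhood was chosen inside the Lipschitz ball of \<open>F\<close> so
      that the bound passes from strictly feasible points to their limit \<open>u\<close>.\<close>
    have "isCont F u"
      using lipschitz_on_continuous_on[OF B] u(2) by (simp add: continuous_on_eq_continuous_at)
    then have "(\<lambda>n. F (w n)) \<longlonglongrightarrow> F u" using w(2) by (rule isCont_tendsto_compose)
    then have "(\<lambda>n. F (w n) + \<rho> / 2 * (norm (w n - p))\<^sup>2) \<longlonglongrightarrow> F u + \<rho> / 2 * (norm (u - p))\<^sup>2"
      using w(2) by (intro tendsto_intros)
    then show "F p \<le> F u + \<rho> / 2 * (norm (u - p))\<^sup>2"
      by (rule LIMSEQ_le_const) (use limit_quadratic_bound w(1) in auto)
  qed
qed

end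

section \<open>Sampled surrogates\<close>

lemma
  assumes "surrogate X \<Xi> c h" "z \<in> \<Xi>" "y \<in> X"
  shows surrogate_ge: "x \<in> X \<Longrightarrow> c x z \<le> h x z y"
    and surrogate_touch: "h y z y = c y z"
  using assms by (simp_all add: surrogate_def)

context iid_sample
begin

lemma surrogate_expval_touch:
  assumes "surrogate X \<Xi> c h" "y \<in> X"
  shows "expval M zt (\<lambda>u z. h u z y) y = expval M zt c y"
  unfolding expval_def using zt_space
  by (intro Bochner_Integration.integral_cong refl surrogate_touch[OF assms(1) _ assms(2)]) auto

text \<open>All sequences are quantified inside the almost sure statement, since iterates and
  accumulation points are random. Surrogates are only upper semicontinuous, so the lower bound uses
  that they majorize \<open>c\<close> and agree with it at the base point.\<close>

lemma AE_surrogate_limits: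
  fixes c :: "'a::euclidean_space \<Rightarrow> 'z \<Rightarrow> real"
  assumes sur: "surrogate X \<Xi> c h" and h: "integrable_surrogate M zt \<Xi> Om X h" and X: "X \<subseteq> Om"
    and int: "\<And>y. y \<in> X \<Longrightarrow> random_integrable M zt \<Xi> (c y)"
    and C: "C \<in> sets R" "measure M {\<omega> \<in> space M. zt \<omega> \<in> C} = 1"
    and Lip: "random_integrable M zt \<Xi> Lip" "\<And>z. z \<in> C \<Longrightarrow> Lip z \<ge> 0"
    and lip: "\<And>z x y. z \<in> C \<Longrightarrow> x \<in> X \<Longrightarrow> y \<in> X \<Longrightarrow> \<bar>c x z - c y z\<bar> \<le> Lip z * norm (x - y)"
  shows "AE \<omega> in M. \<forall>n x x' p. filterlim n at_top sequentially \<longrightarrow> (\<forall>j::nat. x j \<in> X \<and> x' j \<in> X) \<longrightarrow>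
    x \<longlonglongrightarrow> p \<longrightarrow> x' \<longlonglongrightarrow> p \<longrightarrow> p \<in> X \<longrightarrow>
    (\<forall>a<expval M zt (\<lambda>u z. h u z p) p. \<forall>\<^sub>F j in sequentially. a < emean (n j) \<omega> (\<lambda>z. h (x' j) z (x j))) \<and>
    (\<forall>u\<in>X. \<forall>a>expval M zt (\<lambda>u z. h u z p) u. \<forall>\<^sub>F j in sequentially. emean (n j) \<omega> (\<lambda>z. h u z (x j)) < a)"
proof -
  obtain B where B: "random_integrable M zt \<Xi> B" "\<forall>z\<in>\<Xi>. \<forall>x\<in>X. \<forall>y\<in>X. h x z y \<le> B z"
    using h unfolding integrable_surrogate_def by blast
  have "AE \<omega> in M. \<forall>p\<in>X \<times> X. \<forall>a>\<integral>\<omega>. (case p of (x, y) \<Rightarrow> \<lambda>z. h x z y) (zt \<omega>) \<partial>M. \<exists>U. open U \<and> p \<in> U \<and>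
    (\<forall>\<^sub>F n in sequentially. \<forall>q\<in>(X \<times> X) \<inter> U. emean n \<omega> (case q of (x, y) \<Rightarrow> \<lambda>z. h x z y) < a)"
  proof (rule AE_emean_sup_less[OF _ _ B(1)])
    show "random_usc_measurable \<Xi> (X \<times> X) (\<lambda>(x, y) z. h x z y)"
      using h by (simp add: integrable_surrogate_def)
    show "integrable M (\<lambda>\<omega>. (case p of (x, y) \<Rightarrow> \<lambda>z. h x z y) (zt \<omega>))" if "p \<in> X \<times> X" for p
      using h that X by (auto simp: integrable_surrogate_def)
    show "(case p of (x, y) \<Rightarrow> \<lambda>z. h x z y) z \<le> B z" if "z \<in> \<Xi>" "p \<in> X \<times> X" for z p
      using B(2) that by auto
    show "usc_on (X \<times> X) (\<lambda>p. (case p of (x, y) \<Rightarrow> \<lambda>z. h x z y) z)" if "z \<in> \<Xi>" for z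
      using sur that by (simp add: surrogate_def case_prod_unfold)
  qed
  moreover have "AE \<omega> in M. \<forall>p\<in>X. \<forall>a<\<integral>\<omega>. c p (zt \<omega>) \<partial>M. \<exists>U. open U \<and> p \<in> U \<and>
    (\<forall>\<^sub>F n in sequentially. \<forall>q\<in>X \<inter> U. a < emean n \<omega> (c q))"
    using int C Lip lip by (rule AE_emean_inf_greater)
  moreover note AE_space
  ultimately show ?thesis
  proof eventually_elim
    case (elim \<omega>)
    show ?case
    proof (intro allI impI conjI ballI)
      fix n :: "nat \<Rightarrow> nat" and x x' :: "nat \<Rightarrow> 'a" and p a
      assume n: "filterlim n at_top sequentially" and X: "\<forall>j. x j \<in> X \<and> x' j \<in> X"
        and lim: "x \<longlonglongrightarrow> p" "x' \<longlonglongrightarrow> p" and p: "p \<in> X"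
      {
        assume a: "a < expval M zt (\<lambda>u z. h u z p) p"
        then have "a < (\<integral>\<omega>. c p (zt \<omega>) \<partial>M)"
          unfolding surrogate_expval_touch[OF sur p] by (simp add: expval_def)
        then obtain U where U: "open U" "p \<in> U"
          "\<forall>\<^sub>F n in sequentially. \<forall>q\<in>X \<inter> U. a < emean n \<omega> (c q)"
          using elim(2) p by blast
        from topological_tendstoD[OF lim(2) U(1,2)] eventually_compose_filterlim[OF U(3) n]
        show "\<forall>\<^sub>F j in sequentially. a < emean (n j) \<omega> (\<lambda>z. h (x' j) z (x j))"
        proof eventually_elim
          case el: (elim j)
          have "a < emean (n j) \<omega> (c (x' j))" using el X by auto
          also have "\<dots> \<le> emean (n j) \<omega> (\<lambda>z. h (x' j) z (x j))"
            using X zs_space elim(3) by (intro emean_mono surrogate_ge[OF sur]) auto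
          finally show ?case .
        qed
      }
      {
        fix u assume u: "u \<in> X" and a: "expval M zt (\<lambda>u z. h u z p) u < a"
        with elim(1)[rule_format, of "(u, p)" a] p obtain U where U: "open U" "(u, p) \<in> U"
          "\<forall>\<^sub>F n in sequentially. \<forall>q\<in>(X \<times> X) \<inter> U. emean n \<omega> (case q of (x, y) \<Rightarrow> \<lambda>z. h x z y) < a"
          by (auto simp: expval_def)
        \<comment> \<open>The first argument stays fixed and only the base point moves; the pairs
          still enter the neighbourhood \<open>U\<close> of \<open>(u, p)\<close>.\<close>
        have "(\<lambda>j. (u, x j)) \<longlonglongrightarrow> (u, p)" using lim by (intro tendsto_intros)
        from topological_tendstoD[OF this U(1,2)] eventually_compose_filterlim[OF U(3) n]
        show "\<forall>\<^sub>F j in sequentially. emean (n j) \<omega> (\<lambda>z. h u z (x j)) < a"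
        proof eventually_elim
          case (elim j)
          then have "(u, x j) \<in> (X \<times> X) \<inter> U" using X u by auto
          from bspec[OF elim(2) this] show ?case by simp
        qed
      }
    qed
  qed
qed

text \<open>The interchange with the expectation is part of \<open>integrable_surrogate\<close>, and
  under the integral surrogate and original have equal directional derivatives at the base
  point.\<close>

lemma dir_deriv_surrogate_expval:
  assumes "surrogate X \<Xi> c h" "integrable_surrogate M zt \<Xi> Om X h" "y \<in> X"
  shows "dir_deriv (expval M zt (\<lambda>u z. h u z y)) y v = (\<integral>\<omega>. dir_deriv (\<lambda>u. c u (zt \<omega>)) y v \<partial>M)"
proof -
  have "dir_deriv (\<lambda>u. h u z y) y v = dir_deriv (\<lambda>u. c u z) y v" if "z \<in> \<Xi>" for z
  proof -
    obtain D where "has_dir_deriv (\<lambda>u. h u z y) y v D" "has_dir_deriv (\<lambda>u. c u z) y v D"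
      using assms(1,3) \<open>z \<in> \<Xi>\<close> unfolding surrogate_def by blast
    then show ?thesis by (simp add: dir_deriv_eq)
  qed
  then have "(\<integral>\<omega>. dir_deriv (\<lambda>u. h u (zt \<omega>) y) y v \<partial>M) = (\<integral>\<omega>. dir_deriv (\<lambda>u. c u (zt \<omega>)) y v \<partial>M)"
    using zt_space by (intro Bochner_Integration.integral_cong) auto
  then show ?thesis using assms by (simp add: integrable_surrogate_def)
qed

text \<open>Dominated convergence of the difference quotients, with majorant
  \<open>Lip (zt \<omega>) * norm v\<close>.\<close>

lemma has_dir_deriv_expval_lipschitz:
  fixes c :: "'a::real_normed_vector \<Rightarrow> 'z \<Rightarrow> real"
  assumes Om: "open Om" "y \<in> Om"
    and int: "\<And>u. u \<in> Om \<Longrightarrow> random_integrable M zt \<Xi> (c u)"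
    and dd: "\<And>z. z \<in> \<Xi> \<Longrightarrow> dir_differentiable_at (\<lambda>u. c u z) y"
    and lip: "\<And>z. z \<in> \<Xi> \<Longrightarrow> (Lip z)-lipschitz_on Om (\<lambda>u. c u z)"
    and Lip: "random_integrable M zt \<Xi> Lip"
  shows "has_dir_deriv (expval M zt c) y v (\<integral>\<omega>. dir_deriv (\<lambda>u. c u (zt \<omega>)) y v \<partial>M)"
  unfolding has_dir_deriv_def tendsto_at_iff_sequentially
proof (intro allI impI)
  fix t :: "nat \<Rightarrow> real" assume t: "\<forall>i. t i \<in> {0<..} - {0}" "t \<longlonglongrightarrow> 0"
  have tpos: "t i > 0" for i using t(1) by auto
  have t0: "filterlim t (at_right 0) sequentially"
    using tpos t(2) by (intro tendsto_imp_filterlim_at_right) auto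
  let ?q = "\<lambda>i \<omega>. (c (y + t i *\<^sub>R v) (zt \<omega>) - c y (zt \<omega>)) / t i"
  have "(\<lambda>i. y + t i *\<^sub>R v) \<longlonglongrightarrow> y + 0 *\<^sub>R v" using t(2) by (intro tendsto_intros)
  then have evOm: "\<forall>\<^sub>F i in sequentially. y + t i *\<^sub>R v \<in> Om"
    by (rule topological_tendstoD) (use Om in auto)
  \<comment> \<open>Integrability and the Lipschitz bound hold on \<open>Om\<close> only; from index
    \<open>i0\<close> on all points lie there, hence the shifted sequence below.\<close>
  then obtain i0 where i0: "\<And>i. i \<ge> i0 \<Longrightarrow> y + t i *\<^sub>R v \<in> Om" by (auto simp: eventually_sequentially)
  have ci: "integrable M (\<lambda>\<omega>. c u (zt \<omega>))" if "u \<in> Om" for u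
    using int[OF that] by (simp add: random_integrable_def)
  have pt: "(\<lambda>i. ?q (i + i0) \<omega>) \<longlonglongrightarrow> dir_deriv (\<lambda>u. c u (zt \<omega>)) y v" if "\<omega> \<in> space M" for \<omega>
  proof (rule LIMSEQ_ignore_initial_segment)
    have "zt \<omega> \<in> \<Xi>" using zt_space that by auto
    from has_dir_deriv_dir_deriv[OF dd[OF this], of v]
    show "(\<lambda>i. ?q i \<omega>) \<longlonglongrightarrow> dir_deriv (\<lambda>u. c u (zt \<omega>)) y v"
      unfolding has_dir_deriv_def by (rule filterlim_compose[OF _ t0])
  qed
  have meas: "?q (i + i0) \<in> borel_measurable M" for i
    using ci[OF Om(2)] ci[OF i0[of "i + i0"]]
    by (intro borel_measurable_divide borel_measurable_diff) (auto intro: borel_measurable_integrable)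
  have "(\<lambda>i. \<integral>\<omega>. ?q (i + i0) \<omega> \<partial>M) \<longlonglongrightarrow> (\<integral>\<omega>. dir_deriv (\<lambda>u. c u (zt \<omega>)) y v \<partial>M)"
  proof (rule integral_dominated_convergence)
    show "(\<lambda>\<omega>. dir_deriv (\<lambda>u. c u (zt \<omega>)) y v) \<in> borel_measurable M"
      by (rule borel_measurable_LIMSEQ_metric[OF meas pt])
    show "integrable M (\<lambda>\<omega>. Lip (zt \<omega>) * norm v)" using Lip by (simp add: random_integrable_def)
    show "AE \<omega> in M. (\<lambda>i. ?q (i + i0) \<omega>) \<longlonglongrightarrow> dir_deriv (\<lambda>u. c u (zt \<omega>)) y v"
      using pt by (rule AE_I2)
    show "AE \<omega> in M. norm (?q (i + i0) \<omega>) \<le> Lip (zt \<omega>) * norm v" for i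
    proof (rule AE_I2)
      fix \<omega> assume "\<omega> \<in> space M"
      then have "zt \<omega> \<in> \<Xi>" using zt_space by auto
      from lipschitz_onD[OF lip[OF this] i0[of "i + i0"] Om(2)] tpos[of "i + i0"]
      show "norm (?q (i + i0) \<omega>) \<le> Lip (zt \<omega>) * norm v"
        by (simp add: dist_norm field_simps)
    qed
  qed (rule meas)
  then have "(\<lambda>i. \<integral>\<omega>. ?q i \<omega> \<partial>M) \<longlonglongrightarrow> (\<integral>\<omega>. dir_deriv (\<lambda>u. c u (zt \<omega>)) y v \<partial>M)"
    by (rule LIMSEQ_offset)
  moreover have "\<forall>\<^sub>F i in sequentially. (\<integral>\<omega>. ?q i \<omega> \<partial>M) = (expval M zt c (y + t i *\<^sub>R v) - expval M zt c y) / t i"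
    using evOm by eventually_elim (simp add: expval_def ci Om)
  ultimately show "((\<lambda>t. (expval M zt c (y + t *\<^sub>R v) - expval M zt c y) / t) \<circ> t)
      \<longlonglongrightarrow> (\<integral>\<omega>. dir_deriv (\<lambda>u. c u (zt \<omega>)) y v \<partial>M)"
    unfolding comp_def by (rule Lim_transform_eventually)
qed

end

text \<open>Bounded and unbounded penalties are treated alike through the real limit
  \<open>\<iota>\<close> of the reciprocals, which is 0 for an infinite limit.\<close>

lemma tendsto_inverse_ereal_limit:
  assumes lam: "(\<lambda>n. ereal (lam n)) \<longlonglongrightarrow> l" and ge: "\<And>n. n \<ge> (1::nat) \<Longrightarrow> lam n \<ge> 1"
  shows "\<exists>\<iota>. (\<lambda>n. 1 / lam n) \<longlonglongrightarrow> \<iota> \<and> 1 / l = ereal \<iota>"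
proof -
  have l1: "l \<ge> 1"
    by (rule LIMSEQ_le_const[OF lam]) (use ge in \<open>auto intro!: exI[of _ 1] simp: one_ereal_def\<close>)
  show ?thesis
  proof (cases l)
    case (real r)
    then have r: "r \<ge> 1" "lam \<longlonglongrightarrow> r" using l1 lam by (auto simp: one_ereal_def)
    then have "(\<lambda>n. 1 / lam n) \<longlonglongrightarrow> 1 / r" by (intro tendsto_intros) auto
    then show ?thesis using real r(1) by (intro exI[of _ "1 / r"]) (auto simp: one_ereal_def)
  next
    case PInf
    then have "filterlim lam at_top sequentially" using lam by (simp add: tendsto_PInfty_eq_at_top)
    then have "(\<lambda>n. 1 / lam n) \<longlonglongrightarrow> 0"
      by (intro tendsto_divide_0[OF tendsto_const] filterlim_at_top_imp_at_infinity)
    then show ?thesis using PInf by (intro exI[of _ 0]) auto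
  qed (use l1 in auto)
qed

section \<open>Accumulation points of the SPSA iterates\<close>

theorem theorem24:
  fixes M :: "'w measure"
    and X Om :: "(real ^ 'n) set"
    and \<Xi> :: "(real ^ 'd) set"
    and zt :: "'w \<Rightarrow> real ^ 'd"
    and zs :: "nat \<Rightarrow> 'w \<Rightarrow> real ^ 'd"
    and K L :: nat
    and \<zeta> :: "nat \<Rightarrow> real"
    and c0 :: "real ^ 'n \<Rightarrow> real ^ 'd \<Rightarrow> real"
    and c :: "nat \<Rightarrow> nat \<Rightarrow> real ^ 'n \<Rightarrow> real ^ 'd \<Rightarrow> real \<Rightarrow> real"
    and ch0 :: "real ^ 'n \<Rightarrow> real ^ 'd \<Rightarrow> real ^ 'n \<Rightarrow> real"
    and ch :: "nat \<Rightarrow> real ^ 'n \<Rightarrow> real ^ 'd \<Rightarrow> real \<Rightarrow> real ^ 'n \<Rightarrow> real"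
    and ck :: "nat \<Rightarrow> real ^ 'n \<Rightarrow> real ^ 'd \<Rightarrow> real \<Rightarrow> real"
    and cbar :: "nat \<Rightarrow> real ^ 'n \<Rightarrow> real \<Rightarrow> real"
    and Lip0 Lipc Lipch :: "real ^ 'd \<Rightarrow> real"
    and \<Xi>c :: "(real ^ 'd) set"
    and W0 W1 W2 \<gamma>0 rho_inf :: real
    and N :: "nat \<Rightarrow> nat"
    and lam rho :: "nat \<Rightarrow> real"
    and lam_inf :: ereal
    and x :: "nat \<Rightarrow> 'w \<Rightarrow> real ^ 'n"
    and \<kappa> :: "nat set"
  defines "ck \<equiv> \<lambda>k y z \<gamma>. \<Sum>l=1..L. c k l y z \<gamma>"
    and "cbar \<equiv> \<lambda>k y \<gamma>. expval M zt (\<lambda>u z. ck k u z \<gamma>) y"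
  assumes prob: "prob_space M"
    and dom: "open Om" "X \<subseteq> Om"
    and zt: "zt \<in> borel_measurable M" "zt \<in> space M \<rightarrow> \<Xi>"
    \<comment> \<open>the expectations of the problem functions are well defined\<close>
    and c0_int: "\<And>y. y \<in> Om \<Longrightarrow> random_integrable M zt \<Xi> (c0 y)"
    and c_int: "\<And>k l y \<gamma>. k \<in> {1..K} \<Longrightarrow> l \<in> {1..L} \<Longrightarrow> y \<in> Om \<Longrightarrow> \<gamma> > 0 \<Longrightarrow>
          random_integrable M zt \<Xi> (\<lambda>z. c k l y z \<gamma>)"
    \<comment> \<open>polytope and nonnegative objective\<close>
    and X: "polyhedron X" "bounded X"
    and c0_nonneg: "\<And>y z. y \<in> X \<Longrightarrow> z \<in> \<Xi> \<Longrightarrow> c0 y z \<ge> 0"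
    \<comment> \<open>objective: directional differentiability, Lipschitz continuity\<close>
    and c0_dd: "\<And>y z. y \<in> Om \<Longrightarrow> z \<in> \<Xi> \<Longrightarrow> dir_differentiable_at (\<lambda>u. c0 u z) y"
    and c0_lip: "\<And>z. z \<in> \<Xi> \<Longrightarrow> Lip0 z > 0 \<and> (Lip0 z)-lipschitz_on Om (\<lambda>u. c0 u z)"
    and Lip0_int: "random_integrable M zt \<Xi> Lip0"
    \<comment> \<open>constraints: Lipschitz continuity in the variable and in the scaling parameter\<close>
    and Lipc: "\<And>z. z \<in> \<Xi> \<Longrightarrow> Lipc z > 0" "random_integrable M zt \<Xi> Lipc"
    and Lipch: "\<And>z. z \<in> \<Xi> \<Longrightarrow> Lipch z > 0" "random_integrable M zt \<Xi> Lipch"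
    and Xic: "\<Xi>c \<in> sets (restrict_space borel \<Xi>)" "measure M {\<omega> \<in> space M. zt \<omega> \<in> \<Xi>c} = 1"
    and Lipc_bdd: "bdd_above (Lipc ` \<Xi>c)"
    and c_lip: "\<And>k l z y1 y2 \<gamma>. k \<in> {1..K} \<Longrightarrow> l \<in> {1..L} \<Longrightarrow> z \<in> \<Xi>c \<Longrightarrow> y1 \<in> X \<Longrightarrow> y2 \<in> X \<Longrightarrow> \<gamma> > 0 \<Longrightarrow>
          \<bar>c k l y1 z \<gamma> - c k l y2 z \<gamma>\<bar> \<le> Lipc z / \<gamma> * norm (y1 - y2)"
    and c_lip_gamma: "\<And>k l z y \<gamma>1 \<gamma>2. k \<in> {1..K} \<Longrightarrow> l \<in> {1..L} \<Longrightarrow> z \<in> \<Xi>c \<Longrightarrow> y \<in> X \<Longrightarrow> \<gamma>1 > 0 \<Longrightarrow> \<gamma>2 > 0 \<Longrightarrow>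
          \<bar>c k l y z \<gamma>1 - c k l y z \<gamma>2\<bar> \<le> Lipch z * (1 + norm y) * \<bar>1 / \<gamma>1 - 1 / \<gamma>2\<bar>"
    \<comment> \<open>constraints: interchange of directional derivative and expectation\<close>
    and c_dd: "\<And>k l z y \<gamma>. k \<in> {1..K} \<Longrightarrow> l \<in> {1..L} \<Longrightarrow> z \<in> \<Xi> \<Longrightarrow> y \<in> X \<Longrightarrow> \<gamma> > 0 \<Longrightarrow>
          dir_differentiable_at (\<lambda>u. c k l u z \<gamma>) y"
    and c_dd_int: "\<And>k l y \<gamma> v. k \<in> {1..K} \<Longrightarrow> l \<in> {1..L} \<Longrightarrow> y \<in> X \<Longrightarrow> \<gamma> > 0 \<Longrightarrow>
          integrable M (\<lambda>\<omega>. dir_deriv (\<lambda>u. c k l u (zt \<omega>) \<gamma>) y v)"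
    and cbar_dd: "\<And>k y \<gamma> v. k \<in> {1..K} \<Longrightarrow> y \<in> X \<Longrightarrow> \<gamma> > 0 \<Longrightarrow>
          has_dir_deriv (\<lambda>u. cbar k u \<gamma>) y v
            (\<Sum>l=1..L. \<integral>\<omega>. dir_deriv (\<lambda>u. c k l u (zt \<omega>) \<gamma>) y v \<partial>M)"
    \<comment> \<open>growth of Rademacher averages\<close>
    and W: "W0 > 0" "W1 > 0" "W2 > 0"
    and rad0: "\<And>m \<beta>. m > 0 \<Longrightarrow> 0 < \<beta> \<Longrightarrow> \<beta> < 1/2 \<Longrightarrow>
          rademacher X \<Xi> c0 m \<le> ennreal (W0 / real m powr \<beta>)"
    and rad: "\<And>k m \<beta> \<gamma>. k \<in> {1..K} \<Longrightarrow> m > 0 \<Longrightarrow> 0 < \<beta> \<Longrightarrow> \<beta> < 1/2 \<Longrightarrow> \<gamma> > 0 \<Longrightarrow>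
          rademacher X \<Xi> (\<lambda>y z. ck k y z \<gamma>) m
            \<le> ennreal (W1 / real m powr \<beta> + W2 / (\<gamma> * sqrt (real m)))"
    \<comment> \<open>surrogates\<close>
    and sur0: "surrogate X \<Xi> c0 ch0"
    and sur: "\<And>k \<gamma>. k \<in> {1..K} \<Longrightarrow> \<gamma> > 0 \<Longrightarrow>
          surrogate X \<Xi> (\<lambda>y z. ck k y z \<gamma>) (\<lambda>u z y. ch k u z \<gamma> y)"
    and sur0_int: "integrable_surrogate M zt \<Xi> Om X ch0"
    and sur_int: "\<And>k. k \<in> {1..K} \<Longrightarrow> integrable_surrogate M zt \<Xi> Om X (\<lambda>u z y. ch k u z \<gamma>0 y)"
    \<comment> \<open>parameters, samples and iterates\<close>
    and gam: "\<gamma>0 > 0"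
    and params: "spsa_parameters X K cbar N lam lam_inf rho rho_inf (\<lambda>_. \<gamma>0)"
    and zs_indep: "prob_space.indep_vars M (\<lambda>_. borel) zs {1..}"
    and zs_distr: "\<And>s. s \<ge> 1 \<Longrightarrow> zs s \<in> space M \<rightarrow> \<Xi> \<and> distr M borel (zs s) = distr M borel zt"
    and iter: "\<And>\<omega>. \<omega> \<in> space M \<Longrightarrow>
          spsa_iterates X K \<zeta> ch0 ch N lam rho (\<lambda>_. \<gamma>0) (\<lambda>s. zs s \<omega>) (\<lambda>\<nu>. x \<nu> \<omega>)"
    and kap: "\<kappa> \<subseteq> {1..}" "infinite \<kappa>"
    and kap_lim: "AE \<omega> in M. ((\<lambda>\<nu>. norm (x (\<nu> + 1) \<omega> - x \<nu> \<omega>)) \<longlongrightarrow> 0) (inf sequentially (principal \<kappa>))"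
  shows "AE \<omega> in M. \<forall>xinf. accumulation_point_along \<kappa> (\<lambda>\<nu>. x \<nu> \<omega>) xinf \<longrightarrow>
    (let f_inf = expval M zt (\<lambda>u z. ch0 u z xinf);
         g_inf = (\<lambda>k. expval M zt (\<lambda>u z. ch k u z \<gamma>0 xinf));
         f = expval M zt c0;
         g = (\<lambda>k y. cbar k y \<gamma>0);
         hatx_exists = (\<exists>xhat \<in> feasible_set X K g_inf \<zeta>.
            (1 / lam_inf) * ereal (f_inf xhat) \<le> (1 / lam_inf) * ereal (f_inf xinf))
     in (xinf \<in> feasible_set X K g \<zeta> \<longleftrightarrow> xinf \<in> feasible_set X K g_inf \<zeta>) \<and>
        (hatx_exists \<longrightarrow> xinf \<in> feasible_set X K g \<zeta>) \<and>
        (hatx_exists \<and> constraint_closure X K g_inf \<zeta> \<longrightarrow>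
           b_stationary f_inf (feasible_set X K g_inf \<zeta>) xinf \<and>
           (directional_slater X K g \<zeta> xinf \<longrightarrow> b_stationary f (feasible_set X K g \<zeta>) xinf)))"
proof -
  interpret prob_space M by (rule prob)
  interpret iid_sample M zt zs \<Xi>
    using zt zs_distr zs_indep by unfold_locales auto
  define f where "f = expval M zt c0"
  define g where "g = (\<lambda>k y. cbar k y \<gamma>0)"
  define fh where "fh = (\<lambda>p. expval M zt (\<lambda>u z. ch0 u z p))"
  define gh where "gh = (\<lambda>p k. expval M zt (\<lambda>u z. ch k u z \<gamma>0 p))"
  \<comment> \<open>Each of the \<open>L\<close> summands of \<open>ck\<close> contributes the
    constant \<open>Lipc z / \<gamma>0\<close>.\<close>
  define Lip where "Lip = (\<lambda>z. real L * Lipc z / \<gamma>0)"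
  have g_ck: "g k = expval M zt (\<lambda>y z. ck k y z \<gamma>0)" for k
    by (simp add: g_def cbar_def)
  have closed_X: "closed X" using X(1) by (rule polyhedron_imp_closed)
  have ck_int: "random_integrable M zt \<Xi> (\<lambda>z. ck k y z \<gamma>0)" if "k \<in> {1..K}" "y \<in> X" for k y
    using c_int[OF that(1) _ _ gam] that(2) dom(2) unfolding ck_def random_integrable_def
    by (intro conjI borel_measurable_sum Bochner_Integration.integrable_sum) auto
  have \<Xi>c_sub: "\<Xi>c \<subseteq> \<Xi>" using sets.sets_into_space[OF Xic(1)] by (simp add: space_restrict_space)
  have Lip_int: "random_integrable M zt \<Xi> Lip"
    using Lipc(2) unfolding Lip_def random_integrable_def by auto
  have Lip_nonneg: "Lip z \<ge> 0" if "z \<in> \<Xi>c" for z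
    using Lipc(1)[of z] that \<Xi>c_sub gam by (auto simp: Lip_def less_imp_le)
  have ck_lip: "\<bar>ck k y1 z \<gamma>0 - ck k y2 z \<gamma>0\<bar> \<le> Lip z * norm (y1 - y2)"
    if "k \<in> {1..K}" "z \<in> \<Xi>c" "y1 \<in> X" "y2 \<in> X" for k z y1 y2
  proof -
    have "\<bar>ck k y1 z \<gamma>0 - ck k y2 z \<gamma>0\<bar> \<le> (\<Sum>l=1..L. \<bar>c k l y1 z \<gamma>0 - c k l y2 z \<gamma>0\<bar>)"
      unfolding ck_def sum_subtractf[symmetric] by (rule sum_abs)
    also have "\<dots> \<le> (\<Sum>l=1..L. Lipc z / \<gamma>0 * norm (y1 - y2))"
      using that gam by (intro sum_mono c_lip) auto
    finally show ?thesis by (simp add: Lip_def)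
  qed
  have c0_int': "\<And>y. y \<in> X \<Longrightarrow> random_integrable M zt \<Xi> (c0 y)" using c0_int dom(2) by auto
  have c0_lip': "\<bar>c0 y1 z - c0 y2 z\<bar> \<le> Lip0 z * norm (y1 - y2)" if "z \<in> \<Xi>" "y1 \<in> X" "y2 \<in> X" for z y1 y2
    using lipschitz_onD[OF conjunct2[OF c0_lip[OF that(1)]], of y1 y2] that dom(2) by (auto simp: dist_norm)
  have \<Xi>_full: "\<Xi> \<in> sets R" "measure M {\<omega> \<in> space M. zt \<omega> \<in> \<Xi>} = 1"
  proof -
    show "\<Xi> \<in> sets R" by (auto simp: sets_restrict_space)
    have "{\<omega> \<in> space M. zt \<omega> \<in> \<Xi>} = space M" using zt(2) by auto
    then show "measure M {\<omega> \<in> space M. zt \<omega> \<in> \<Xi>} = 1" by (simp add: prob_space)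
  qed

  \<comment> \<open>Agreement of surrogate and original expectations at the base point\<close>
  have dd_f: "has_dir_deriv f p v (dir_deriv (fh p) p v)" if p: "p \<in> X" for p v
    unfolding f_def fh_def dir_deriv_surrogate_expval[OF sur0 sur0_int p]
    using p dom c0_lip Lip0_int by (intro has_dir_deriv_expval_lipschitz[OF dom(1) _ c0_int c0_dd]) auto
  have dd_g: "has_dir_deriv (g k) p v (dir_deriv (gh p k) p v)" if k: "k \<in> {1..K}" and p: "p \<in> X" for k p v
  proof -
    have "dir_deriv (\<lambda>u. ck k u z \<gamma>0) p v = (\<Sum>l=1..L. dir_deriv (\<lambda>u. c k l u z \<gamma>0) p v)" if "z \<in> \<Xi>" for z
      unfolding ck_def
      by (intro dir_deriv_eq has_dir_deriv_sum has_dir_deriv_dir_deriv c_dd[OF k _ that p gam])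
    then have "dir_deriv (gh p k) p v = (\<integral>\<omega>. (\<Sum>l=1..L. dir_deriv (\<lambda>u. c k l u (zt \<omega>) \<gamma>0) p v) \<partial>M)"
      unfolding gh_def dir_deriv_surrogate_expval[OF sur[OF k gam] sur_int[OF k] p]
      using zt(2) by (intro Bochner_Integration.integral_cong) auto
    also have "\<dots> = (\<Sum>l=1..L. \<integral>\<omega>. dir_deriv (\<lambda>u. c k l u (zt \<omega>) \<gamma>0) p v \<partial>M)"
      by (rule Bochner_Integration.integral_sum) (rule c_dd_int[OF k _ p gam])
    finally show ?thesis using cbar_dd[OF k p gam] by (simp add: g_def)
  qed
  have touch: "gh p k p = g k p" if "k \<in> {1..K}" "p \<in> X" for k p
    unfolding gh_def g_ck by (rule surrogate_expval_touch[OF sur[OF that(1) gam] that(2)])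
  have bdiff_f: "b_differentiable_at (fh p) p" if "p \<in> X" for p
    using sur0_int that by (simp add: integrable_surrogate_def fh_def)
  have bdiff_g: "b_differentiable_at (gh p k) p" if "k \<in> {1..K}" "p \<in> X" for k p
    using sur_int[OF that(1)] that(2) by (simp add: integrable_surrogate_def gh_def)
  have g_lip: "\<bar>g k u - g k w\<bar> \<le> (\<integral>\<omega>. Lip (zt \<omega>) \<partial>M) * norm (u - w)"
    if "k \<in> {1..K}" "u \<in> X" "w \<in> X" for k u w
    unfolding g_ck expval_def using ck_int[OF that(1)] Xic Lip_int ck_lip[OF that(1)] that(2,3)
    by (rule expectation_lipschitz)

  \<comment> \<open>Limits of the algorithm parameters\<close>
  have N: "strict_mono N" and lam: "mono_on {1..} lam" "\<And>\<nu>. \<nu> \<ge> 1 \<Longrightarrow> lam \<nu> > 0" "lam 1 = 1"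
    "(\<lambda>\<nu>. ereal (lam \<nu>)) \<longlonglongrightarrow> lam_inf"
    and rho: "\<And>\<nu>. \<nu> \<ge> 1 \<Longrightarrow> rho \<nu> > 0" "rho \<longlonglongrightarrow> rho_inf"
    using params by (auto simp: spsa_parameters_def)
  obtain \<alpha>2 where \<alpha>2: "\<And>\<nu>. \<nu> \<ge> 1 \<Longrightarrow> rho \<nu> / lam \<nu> \<le> \<alpha>2 / real \<nu>"
    using params unfolding spsa_parameters_def by blast
  have lam_ge: "lam \<nu> \<ge> 1" if "\<nu> \<ge> 1" for \<nu> using mono_onD[OF lam(1), of 1 \<nu>] that lam(3) by auto
  obtain \<iota> where \<iota>: "(\<lambda>\<nu>. 1 / lam \<nu>) \<longlonglongrightarrow> \<iota>" "1 / lam_inf = ereal \<iota>"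
    using tendsto_inverse_ereal_limit[OF lam(4) lam_ge] by blast
  have rho_lam: "(\<lambda>\<nu>. rho \<nu> / lam \<nu>) \<longlonglongrightarrow> 0"
  proof (rule tendsto_sandwich[of "\<lambda>_. 0"])
    show "\<forall>\<^sub>F \<nu> in sequentially. 0 \<le> rho \<nu> / lam \<nu>"
      using eventually_ge_at_top[of 1] by eventually_elim (simp add: rho lam less_imp_le)
    show "\<forall>\<^sub>F \<nu> in sequentially. rho \<nu> / lam \<nu> \<le> \<alpha>2 / real \<nu>"
      using eventually_ge_at_top[of 1] by eventually_elim (rule \<alpha>2)
    show "(\<lambda>\<nu>. \<alpha>2 / real \<nu>) \<longlonglongrightarrow> 0" by (rule lim_const_over_n)
  qed simp

  \<comment> \<open>Almost sure conclusions for the surrogate problem\<close>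
  let ?lims = "\<lambda>h \<omega>. \<forall>n x x' p. filterlim n at_top sequentially \<longrightarrow> (\<forall>j::nat. x j \<in> X \<and> x' j \<in> X) \<longrightarrow>
    x \<longlonglongrightarrow> p \<longrightarrow> x' \<longlonglongrightarrow> p \<longrightarrow> p \<in> X \<longrightarrow>
    (\<forall>a<expval M zt (\<lambda>u z. h u z p) p. \<forall>\<^sub>F j in sequentially. a < emean (n j) \<omega> (\<lambda>z. h (x' j) z (x j))) \<and>
    (\<forall>u\<in>X. \<forall>a>expval M zt (\<lambda>u z. h u z p) u. \<forall>\<^sub>F j in sequentially. emean (n j) \<omega> (\<lambda>z. h u z (x j)) < a)"
  have AE0: "AE \<omega> in M. ?lims ch0 \<omega>"
    by (rule AE_surrogate_limits[OF sur0 sur0_int dom(2) c0_int' \<Xi>_full Lip0_int _ c0_lip'])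
       (use c0_lip in \<open>auto simp: less_imp_le\<close>)
  have "AE \<omega> in M. ?lims (\<lambda>u z y. ch k u z \<gamma>0 y) \<omega>" if k: "k \<in> {1..K}" for k
    by (rule AE_surrogate_limits[OF sur[OF k gam] sur_int[OF k] dom(2) ck_int[OF k] Xic Lip_int Lip_nonneg ck_lip[OF k]])
  then have AEk: "AE \<omega> in M. \<forall>k\<in>{1..K}. ?lims (\<lambda>u z y. ch k u z \<gamma>0 y) \<omega>"
    by (subst AE_ball_countable) auto
  from kap_lim AE0 AEk AE_space
  have "AE \<omega> in M. \<forall>p. accumulation_point_along \<kappa> (\<lambda>\<nu>. x \<nu> \<omega>) p \<longrightarrow> p \<in> X \<and>
    ((\<exists>u\<in>feasible_set X K (gh p) \<zeta>. \<iota> * fh p u \<le> \<iota> * fh p p) \<longrightarrow> p \<in> feasible_set X K (gh p) \<zeta>) \<and>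
    (p \<in> feasible_set X K (gh p) \<zeta> \<and> constraint_closure X K (gh p) \<zeta> \<longrightarrow>
       b_stationary (fh p) (feasible_set X K (gh p) \<zeta>) p)"
  proof eventually_elim
    case (elim \<omega>)
    show ?case
    proof (intro allI impI)
      fix p assume "accumulation_point_along \<kappa> (\<lambda>\<nu>. x \<nu> \<omega>) p"
      then obtain r where r: "strict_mono r" "range r \<subseteq> \<kappa>" and lim: "(\<lambda>j. x (r j) \<omega>) \<longlonglongrightarrow> p"
        by (auto simp: accumulation_point_along_def)
      have r1: "r j \<ge> 1" for j using r(2) kap(1) by auto
      have r_top: "filterlim r at_top sequentially" using r(1) by (rule filterlim_subseq)
      have xX: "x \<nu> \<omega> \<in> X" if "\<nu> \<ge> 1" for \<nu>
      proof (cases "\<nu> = 1")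
        case False
        then obtain \<mu> where "\<nu> = \<mu> + 1" "\<mu> \<ge> 1" using \<open>\<nu> \<ge> 1\<close> by (cases \<nu>) auto
        then show ?thesis using iter[OF elim(4)] by (auto simp: spsa_iterates_def is_arg_min_def)
      qed (use iter[OF elim(4)] in \<open>auto simp: spsa_iterates_def\<close>)
      have pX: "p \<in> X" using closed_sequentially[OF closed_X _ lim] xX r1 by blast
      \<comment> \<open>The steps are known to vanish only inside \<open>\<kappa>\<close>, and
        \<open>r\<close> runs to infinity inside \<open>\<kappa>\<close>.\<close>
      have "filterlim r (inf sequentially (principal \<kappa>)) sequentially"
        using r_top r(2) by (auto simp: filterlim_inf filterlim_principal intro!: always_eventually)
      from filterlim_compose[OF elim(1) this]
      have "(\<lambda>j. x (r j + 1) \<omega> - x (r j) \<omega>) \<longlonglongrightarrow> 0" by (rule tendsto_norm_zero_cancel)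
      from tendsto_add[OF this lim] have lim': "(\<lambda>j. x (r j + 1) \<omega>) \<longlonglongrightarrow> p" by simp
      have n: "filterlim (\<lambda>j. N (r j)) at_top sequentially"
        using filterlim_compose[OF filterlim_subseq[OF N] r_top] .
      have inX: "\<forall>j. x (r j) \<omega> \<in> X \<and> x (r j + 1) \<omega> \<in> X" using xX r1 by (simp add: le_SucI)
      \<comment> \<open>The outcome is fixed here, so the limits may be instantiated with sequences
        and a limit point depending on it.\<close>
      note lims0 = elim(2)[rule_format, OF n inX[rule_format] lim lim' pX]
      note limsk = elim(3)[rule_format, OF _ n inX[rule_format] lim lim' pX]
      interpret penalized_minimizers X K \<zeta> "\<lambda>j u. emean (N (r j)) \<omega> (\<lambda>z. ch0 u z (x (r j) \<omega>))"
        "\<lambda>k j u. emean (N (r j)) \<omega> (\<lambda>z. ch k u z \<gamma>0 (x (r j) \<omega>))" "fh p" "gh p"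
        "\<lambda>j. x (r j) \<omega>" "\<lambda>j. x (r j + 1) \<omega>" p "\<lambda>j. lam (r j)" "\<lambda>j. rho (r j)" \<iota> rho_inf
      proof
        fix j u assume u: "u \<in> X"
        have "is_arg_min (spsa_objective K \<zeta> ch0 ch (\<lambda>s. zs s \<omega>) (N (r j)) (lam (r j)) (rho (r j)) \<gamma>0 (x (r j) \<omega>))
            (\<lambda>y. y \<in> X) (x (r j + 1) \<omega>)"
          using iter[OF elim(4)] r1[of j] by (auto simp: spsa_iterates_def)
        then have "spsa_objective K \<zeta> ch0 ch (\<lambda>s. zs s \<omega>) (N (r j)) (lam (r j)) (rho (r j)) \<gamma>0 (x (r j) \<omega>) (x (r j + 1) \<omega>)
            \<le> spsa_objective K \<zeta> ch0 ch (\<lambda>s. zs s \<omega>) (N (r j)) (lam (r j)) (rho (r j)) \<gamma>0 (x (r j) \<omega>) u"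
          using u by (auto simp: is_arg_min_def not_less)
        then show "emean (N (r j)) \<omega> (\<lambda>z. ch0 (x (r j + 1) \<omega>) z (x (r j) \<omega>))
            + lam (r j) * (\<Sum>k=1..K. max (emean (N (r j)) \<omega> (\<lambda>z. ch k (x (r j + 1) \<omega>) z \<gamma>0 (x (r j) \<omega>)) - \<zeta> k) 0)
            + rho (r j) / 2 * (norm (x (r j + 1) \<omega> - x (r j) \<omega>))\<^sup>2
          \<le> emean (N (r j)) \<omega> (\<lambda>z. ch0 u z (x (r j) \<omega>))
            + lam (r j) * (\<Sum>k=1..K. max (emean (N (r j)) \<omega> (\<lambda>z. ch k u z \<gamma>0 (x (r j) \<omega>)) - \<zeta> k) 0)
            + rho (r j) / 2 * (norm (u - x (r j) \<omega>))\<^sup>2"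
          unfolding spsa_objective_def emean_def .
      next
        show "lam (r j) > 0" "rho (r j) > 0" for j using r1 lam(2) rho(1) by auto
        show "(\<lambda>j. 1 / lam (r j)) \<longlonglongrightarrow> \<iota>" by (rule filterlim_compose[OF \<iota>(1) r_top])
        show "(\<lambda>j. rho (r j) / lam (r j)) \<longlonglongrightarrow> 0" by (rule filterlim_compose[OF rho_lam r_top])
        show "(\<lambda>j. rho (r j)) \<longlonglongrightarrow> rho_inf" by (rule filterlim_compose[OF rho(2) r_top])
      qed (use lims0 limsk lim in \<open>auto simp: fh_def gh_def\<close>)
      show "p \<in> X \<and>
        ((\<exists>u\<in>feasible_set X K (gh p) \<zeta>. \<iota> * fh p u \<le> \<iota> * fh p p) \<longrightarrow> p \<in> feasible_set X K (gh p) \<zeta>) \<and>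
        (p \<in> feasible_set X K (gh p) \<zeta> \<and> constraint_closure X K (gh p) \<zeta> \<longrightarrow>
           b_stationary (fh p) (feasible_set X K (gh p) \<zeta>) p)"
        using limit_feasible limit_b_stationary bdiff_f[OF pX] pX by (auto simp: feasible_set_def[of X K "gh p"])
    qed
  qed

  \<comment> \<open>Return to the original problem\<close>
  then show ?thesis
  proof eventually_elim
    case (elim \<omega>)
    show ?case
    proof (intro allI impI)
      fix p assume "accumulation_point_along \<kappa> (\<lambda>\<nu>. x \<nu> \<omega>) p"
      with elim have pX: "p \<in> X"
        and a: "\<And>u. u \<in> feasible_set X K (gh p) \<zeta> \<Longrightarrow> \<iota> * fh p u \<le> \<iota> * fh p p \<Longrightarrow> p \<in> feasible_set X K (gh p) \<zeta>"
        and b: "p \<in> feasible_set X K (gh p) \<zeta> \<Longrightarrow> constraint_closure X K (gh p) \<zeta> \<Longrightarrow>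
          b_stationary (fh p) (feasible_set X K (gh p) \<zeta>) p" by blast+
      have eq: "p \<in> feasible_set X K g \<zeta> \<longleftrightarrow> p \<in> feasible_set X K (gh p) \<zeta>"
        using touch[OF _ pX] by (auto simp: feasible_set_def)
      have c: "b_stationary f (feasible_set X K g \<zeta>) p"
        if "p \<in> feasible_set X K g \<zeta>" "b_stationary (fh p) (feasible_set X K (gh p) \<zeta>) p"
          "directional_slater X K g \<zeta> p"
        by (rule b_stationary_transfer[OF X(1) that(1) touch[OF _ pX] g_lip bdiff_g[OF _ pX]
              dd_g[OF _ pX] bdiff_f[OF pX] dd_f[OF pX] that(2,3)])
      show "let f_inf = expval M zt (\<lambda>u z. ch0 u z p);
         g_inf = (\<lambda>k. expval M zt (\<lambda>u z. ch k u z \<gamma>0 p));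
         f = expval M zt c0;
         g = (\<lambda>k y. cbar k y \<gamma>0);
         hatx_exists = (\<exists>xhat \<in> feasible_set X K g_inf \<zeta>.
            (1 / lam_inf) * ereal (f_inf xhat) \<le> (1 / lam_inf) * ereal (f_inf p))
       in (p \<in> feasible_set X K g \<zeta> \<longleftrightarrow> p \<in> feasible_set X K g_inf \<zeta>) \<and>
        (hatx_exists \<longrightarrow> p \<in> feasible_set X K g \<zeta>) \<and>
        (hatx_exists \<and> constraint_closure X K g_inf \<zeta> \<longrightarrow>
           b_stationary f_inf (feasible_set X K g_inf \<zeta>) p \<and>
           (directional_slater X K g \<zeta> p \<longrightarrow> b_stationary f (feasible_set X K g \<zeta>) p))"
        unfolding Let_def \<iota>(2) g_def[symmetric] f_def[symmetric] fh_def[symmetric, THEN fun_cong] gh_def[symmetric, THEN fun_cong]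
        using a b c eq by auto
    qed
  qed
qed

end
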